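(* Let $d\ge 1$ and let $f:\mathbb N\to\mathbb N$ be a nondecreasing computable function such that the series $\sum_{n\ge1}\frac{f(n)}{n^2}$ converges at a computable rate. Then there is an algorithm that computes the entropy of $f$-block gluing $d$-dimensional decidable subshifts.
   Context: A $d$-dimensional subshift $\Sigma$ on a finite alphabet $\mathcal A$ is a closed shift-invariant subset of $\mathcal A^{\mathbb Z^d}$ (product topology); subshifts are taken nonempty. For finite $\mathbb U\subset\mathbb Z^d$, $\mathcal L_{\mathbb U}(\Sigma)=\{x|_{\mathbb U}: x\in\Sigma\}$, and $\mathcal L(\Sigma)=\bigcup_{\mathbb U}\mathcal L_{\mathbb U}(\Sigma)$ is the language. $\Sigma$ is decidable if membership in $\mathcal L(\Sigma)$, for patterns on finite supports, is a computable (Turing-decidable) property. The entropy is $h_{\mathrm{top}}(\Sigma)=\lim_{n\to\infty}\frac{\log_2\#\mathcal L_{[0,n-1]^d}(\Sigma)}{n^d}$. With $d(\vec i,\vec j)=\max_k|i_k-j_k|$ on $\mathbb Z^d$, for nonempty finite sets put $\delta(\mathbb U)=\max_{i,j\in\mathbb U}d(i,j)$ and $d(\mathbb U,\mathbb V)=\min_{i\in\mathbb U,j\in\mathbb V}d(i,j)$. $\Sigma$ is $f$-block gluing if for every $n\ge1$, all disjoint translates $\mathbb U,\mathbb V$ of $[0,n-1]^d$ in $\mathbb Z^d$ with $d(\mathbb U,\mathbb V)\ge f(\max(\delta(\mathbb U),\delta(\mathbb V)))$, and all $u\in\mathcal L_{\mathbb U}(\Sigma)$, $v\in\mathcal L_{\mathbb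 V}(\Sigma)$, there is $x\in\Sigma$ with $x|_{\mathbb U}=u$ and $x|_{\mathbb V}=v$. A series $\sum a_n$ of nonnegative reals converges at a computable rate if there is a computable $n:\mathbb N\to\mathbb N$ with $\sum_{k\ge n(t)}a_k\le 2^{-t}$ for all $t\in\mathbb N$. An algorithm computes the entropy of a class $\mathcal C$ of decidable $d$-dimensional subshifts if there is a Turing machine which, on input $(n,m)$, where $n$ is an index specifying a finite alphabet and a Turing machine deciding the language of some $\Sigma\in\mathcal C$, halts and outputs a rational $r_{n,m}$ with $|h_{\mathrm{top}}(\Sigma)-r_{n,m}|\le 2^{-m}$; nothing is required on other inputs. *)

theory Defs
  imports "HOL-Analysis.Analysis" "HOL-Library.Nat_Bijection" "HOL-Library.Countable"
begin

section \<open>Turing machines\<close>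

datatype direction = Move_left | Stay | Move_right

text \<open>
  A machine is a finite table of instructions: in state \<open>q\<close> reading symbol \<open>a\<close>, an entry
  \<open>((q, a), (q', b, D))\<close> writes \<open>b\<close>, moves by \<open>D\<close> and enters state \<open>q'\<close>. If several entries share
  the key \<open>(q, a)\<close>, the first one applies, so machines are deterministic; a machine halts when no
  entry applies. There is one two-way infinite tape; \<open>0\<close> is both the initial state and the blank
  symbol. States and symbols are numbers, finitely many of which occur in a given table.
\<close>

type_synonym tm = "((nat \<times> nat) \<times> (nat \<times> nat \<times> direction)) list"
type_synonym tm_config = "nat \<times> (int \<Rightarrow> nat) \<times> int"

fun offset :: "direction \<Rightarrow> int" where
  "offset Move_left = -1"
| "offset Stay = 0"
| "offset Move_right = 1"

fun tm_halted :: "tm \<Rightarrow> tm_config \<Rightarrow> bool" where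
  "tm_halted M (q, T, p) \<longleftrightarrow> map_of M (q, T p) = None"

fun tm_step :: "tm \<Rightarrow> tm_config \<Rightarrow> tm_config" where
  "tm_step M (q, T, p) =
     (case map_of M (q, T p) of
        None \<Rightarrow> (q, T, p)
      | Some (q', b, D) \<Rightarrow> (q', T(p := b), p + offset D))"

text \<open>Numbers are in unary: the input is a block of \<open>n\<close> ones starting at the head, on an otherwise
  blank tape; the output is the length of the maximal block of ones starting at the head.\<close>

definition tm_initial :: "nat \<Rightarrow> tm_config" where
  "tm_initial n = (0, (\<lambda>i. if 0 \<le> i \<and> i < int n then 1 else 0), 0)"

fun tm_output :: "tm_config \<Rightarrow> nat \<Rightarrow> bool" where
  "tm_output (q, T, p) y \<longleftrightarrow> (\<forall>i<y. T (p + int i) = 1) \<and> T (p + int y) \<noteq> 1"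

definition tm_returns :: "tm \<Rightarrow> nat \<Rightarrow> nat \<Rightarrow> bool" where
  "tm_returns M n y \<longleftrightarrow>
     (\<exists>k. tm_halted M ((tm_step M ^^ k) (tm_initial n)) \<and>
          tm_output ((tm_step M ^^ k) (tm_initial n)) y)"

definition computable :: "(nat \<Rightarrow> nat) \<Rightarrow> bool" where
  "computable g \<longleftrightarrow> (\<exists>M. \<forall>n. tm_returns M n (g n))"

fun direction_code :: "direction \<Rightarrow> nat" where
  "direction_code Move_left = 0"
| "direction_code Stay = 1"
| "direction_code Move_right = 2"

fun instruction_code :: "(nat \<times> nat) \<times> (nat \<times> nat \<times> direction) \<Rightarrow> nat" where
  "instruction_code ((q, a), (q', b, D)) =
     prod_encode (q, prod_encode (a, prod_encode (q', prod_encode (b, direction_code D))))"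

definition tm_code :: "tm \<Rightarrow> nat" where
  "tm_code M = list_encode (map instruction_code M)"

lemma inj_tm_code: "inj tm_code"
proof (rule injI)
  have dir: "direction_code D = direction_code E \<Longrightarrow> D = E" for D E
    by (cases D; cases E) simp_all
  have "inj instruction_code"
  proof (rule injI)
    fix x y assume "instruction_code x = instruction_code y"
    then show "x = y"
      by (cases x rule: instruction_code.cases; cases y rule: instruction_code.cases)
        (auto dest: dir)
  qed
  then show "M = N" if "tm_code M = tm_code N" for M N
    using that by (simp add: tm_code_def inj_map_eq_map list_encode_eq)
qed


section \<open>Series converging at a computable rate\<close>

definition converges_computably :: "(nat \<Rightarrow> real) \<Rightarrow> bool" where
  "converges_computably a \<longleftrightarrow>
     (\<forall>k. a k \<ge> 0) \<and> summable a \<and>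
     (\<exists>n. computable n \<and> (\<forall>t. (\<Sum>k. a (n t + k)) \<le> 1 / 2 ^ t))"


section \<open>Subshifts\<close>

text \<open>Points of the lattice are lists of \<open>d\<close> integers; configurations over the alphabet \<open>A\<close> are
  the elements of \<open>lattice d \<rightarrow>\<^sub>E A\<close>.\<close>

definition lattice :: "nat \<Rightarrow> int list set" where
  "lattice d = {v. length v = d}"

definition vadd :: "int list \<Rightarrow> int list \<Rightarrow> int list" where
  "vadd u v = map2 (+) u v"

definition translate :: "int list \<Rightarrow> int list set \<Rightarrow> int list set" where
  "translate v U = vadd v ` U"

definition cube :: "nat \<Rightarrow> nat \<Rightarrow> int list set" where
  "cube d n = {v \<in> lattice d. set v \<subseteq> {0..int n - 1}}"

definition shift :: "nat \<Rightarrow> int list \<Rightarrow> (int list \<Rightarrow> 'a) \<Rightarrow> (int list \<Rightarrow> 'a)" where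
  "shift d v x = (\<lambda>i\<in>lattice d. x (vadd i v))"

definition subshift :: "nat \<Rightarrow> 'a set \<Rightarrow> (int list \<Rightarrow> 'a) set \<Rightarrow> bool" where
  "subshift d A \<Sigma> \<longleftrightarrow>
     finite A \<and> \<Sigma> \<noteq> {} \<and>
     closedin (product_topology (\<lambda>_. discrete_topology A) (lattice d)) \<Sigma> \<and>
     (\<forall>v\<in>lattice d. shift d v ` \<Sigma> = \<Sigma>)"

text \<open>A pattern is a partial map; its domain is its support.\<close>

definition pattern_at :: "(int list \<Rightarrow> 'a) \<Rightarrow> int list set \<Rightarrow> (int list \<rightharpoonup> 'a)" where
  "pattern_at x U = (Some \<circ> x) |` U"

definition language_on :: "(int list \<Rightarrow> 'a) set \<Rightarrow> int list set \<Rightarrow> (int list \<rightharpoonup> 'a) set" where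
  "language_on \<Sigma> U = (\<lambda>x. pattern_at x U) ` \<Sigma>"

definition language :: "nat \<Rightarrow> (int list \<Rightarrow> 'a) set \<Rightarrow> (int list \<rightharpoonup> 'a) set" where
  "language d \<Sigma> = (\<Union>U \<in> {U. finite U \<and> U \<subseteq> lattice d}. language_on \<Sigma> U)"

definition entropy :: "nat \<Rightarrow> (int list \<Rightarrow> 'a) set \<Rightarrow> real" where
  "entropy d \<Sigma> = lim (\<lambda>n. log 2 (real (card (language_on \<Sigma> (cube d n)))) / real n ^ d)"


subsection \<open>Block gluing\<close>

text \<open>The maximum, and hence the notions below, is meaningful for \<open>d \<ge> 1\<close> only.\<close>

definition zdist :: "nat \<Rightarrow> int list \<Rightarrow> int list \<Rightarrow> nat" where
  "zdist d i j = Max ((\<lambda>k. nat \<bar>i ! k - j ! k\<bar>) ` {..<d})"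

definition zdiam :: "nat \<Rightarrow> int list set \<Rightarrow> nat" where
  "zdiam d U = Max {zdist d i j | i j. i \<in> U \<and> j \<in> U}"

definition zsetdist :: "nat \<Rightarrow> int list set \<Rightarrow> int list set \<Rightarrow> nat" where
  "zsetdist d U V = Min {zdist d i j | i j. i \<in> U \<and> j \<in> V}"

definition block_gluing :: "nat \<Rightarrow> (nat \<Rightarrow> nat) \<Rightarrow> (int list \<Rightarrow> 'a) set \<Rightarrow> bool" where
  "block_gluing d f \<Sigma> \<longleftrightarrow>
     (\<forall>n\<ge>1. \<forall>a\<in>lattice d. \<forall>b\<in>lattice d.
        let U = translate a (cube d n); V = translate b (cube d n) in
          U \<inter> V = {} \<longrightarrow> zsetdist d U V \<ge> f (max (zdiam d U) (zdiam d V)) \<longrightarrow>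
          (\<forall>u\<in>language_on \<Sigma> U. \<forall>v\<in>language_on \<Sigma> V.
             \<exists>x\<in>\<Sigma>. pattern_at x U = u \<and> pattern_at x V = v))"


section \<open>Decidable subshifts and computing the entropy\<close>

text \<open>For input to a machine, a pattern \<open>map_of ps\<close> on a finite support over an alphabet of numbers
  is given by any list \<open>ps\<close>, without repetition, of its positions together with their symbols.\<close>

definition pattern_listings :: "nat \<Rightarrow> nat set \<Rightarrow> (int list \<times> nat) list set" where
  "pattern_listings d A =
     {ps. distinct (map fst ps) \<and> fst ` set ps \<subseteq> lattice d \<and> snd ` set ps \<subseteq> A}"

definition pattern_code :: "(int list \<times> nat) list \<Rightarrow> nat" where
  "pattern_code ps =
     list_encode (map (\<lambda>(v, a). prod_encode (list_encode (map int_encode v), a)) ps)"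

definition decides_language :: "tm \<Rightarrow> nat \<Rightarrow> nat set \<Rightarrow> (int list \<Rightarrow> nat) set \<Rightarrow> bool" where
  "decides_language M d A \<Sigma> \<longleftrightarrow>
     (\<forall>ps\<in>pattern_listings d A.
        tm_returns M (pattern_code ps) (if map_of ps \<in> language d \<Sigma> then 1 else 0))"

definition decidable_subshift :: "nat \<Rightarrow> nat set \<Rightarrow> (int list \<Rightarrow> nat) set \<Rightarrow> bool" where
  "decidable_subshift d A \<Sigma> \<longleftrightarrow> subshift d A \<Sigma> \<and> (\<exists>M. decides_language M d A \<Sigma>)"

definition subshift_index :: "nat set \<Rightarrow> tm \<Rightarrow> nat" where
  "subshift_index A M = prod_encode (set_encode A, tm_code M)"

text \<open>A class \<open>C\<close> of decidable subshifts is a set of pairs of a finite alphabet \<open>A\<close> and a subshift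
  over \<open>A\<close>. An output \<open>y\<close> of the machine \<open>E\<close> denotes the rational number
  \<open>nat_to_rat_surj y\<close>.\<close>

definition computes_entropy :: "tm \<Rightarrow> nat \<Rightarrow> (nat set \<times> (int list \<Rightarrow> nat) set) set \<Rightarrow> bool" where
  "computes_entropy E d C \<longleftrightarrow>
     (\<forall>(A, \<Sigma>)\<in>C. \<forall>M m. decides_language M d A \<Sigma> \<longrightarrow>
        (\<exists>y. tm_returns E (prod_encode (subshift_index A M, m)) y \<and>
             \<bar>entropy d \<Sigma> - real_of_rat (nat_to_rat_surj y)\<bar> \<le> 1 / 2 ^ m))"

end

theory Submission
  imports Defs
begin

text \<open>
  Write \<open>L n\<close> for the binary logarithm of the number of patterns on a cube of side \<open>n\<close>. It is
  subadditive, so the entropy \<open>h\<close> is the infimum of \<open>L n / n\<^sup>d\<close>. Gluing one coordinate direction at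
  a time gives \<open>L (2 n + f (4 n)) \<ge> 2\<^sup>d L n\<close> as soon as \<open>f (4 n) \<le> n\<close>, and iterating this shows that
  \<open>h\<close> exceeds \<open>L n / n\<^sup>d\<close> times \<open>1 - 8 d \<epsilon>\<close>, where \<open>\<epsilon>\<close> bounds the tail of \<open>\<Sum> f k / k\<^sup>2\<close> from \<open>4 n\<close> on.
  Hence \<open>\<lfloor>L n\<rfloor> / n\<^sup>d\<close> approximates \<open>h\<close> with an error that can be read off from the rate of
  convergence, and it suffices to count the patterns on a single cube.

  The count is made by a machine of Kleene's normal form: one unbounded search over a bound \<open>y\<close> on
  codes and running times, with a primitive recursive test. The machine computing the rate and the
  machine deciding the language are only simulated, so machines never have to be composed.
\<close>

section \<open>Turing machines from register programs\<close>

text \<open>Block gluing concerns two cubes of equal side, whereas gluing one coordinate at a time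
  creates bricks with unequal sides. As long as \<open>f (4 * n) \<le> n\<close>, all sides stay
  below \<open>4 * n\<close>, so each brick fits into a cube of side \<open>4 * n\<close>; this is
  why the gap is \<open>f (4 * n)\<close> and why tails start at \<open>4 * n\<close>. The smallness
  of \<open>f (4 * n)\<close> itself follows from a small tail, because \<open>f\<close> is
  monotone.

  The lower bound for the entropy has a relative error. It becomes absolute because
  \<open>L n / n^d\<close> is at most the logarithm of the alphabet size, which the code of the
  alphabet bounds; so the required tail can be computed from the input.

  The unbounded search needs a decidable sign that it has gone far enough. The decider is trusted
  only on codes of genuine patterns, and all of these must have been seen. Listing each pattern in
  one canonical order makes their number \<open>card A ^ (n ^ d)\<close>, known beforehand, and
  reaching this count certifies that none is missing.\<close>

datatype prog =
    Inc nat
  | Dec nat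
  | Seq prog prog
  | Branch nat prog prog
  | While nat prog

inductive exec :: "prog \<Rightarrow> (nat \<Rightarrow> nat) \<Rightarrow> (nat \<Rightarrow> nat) \<Rightarrow> bool" where
  exec_Inc: "exec (Inc r) \<sigma> (\<sigma>(r := Suc (\<sigma> r)))"
| exec_Dec: "exec (Dec r) \<sigma> (\<sigma>(r := \<sigma> r - 1))"
| exec_Seq: "exec P \<sigma> \<tau> \<Longrightarrow> exec Q \<tau> \<rho> \<Longrightarrow> exec (Seq P Q) \<sigma> \<rho>"
| exec_Branch_True: "\<sigma> r \<noteq> 0 \<Longrightarrow> exec P \<sigma> \<tau> \<Longrightarrow> exec (Branch r P Q) \<sigma> \<tau>"
| exec_Branch_False: "\<sigma> r = 0 \<Longrightarrow> exec Q \<sigma> \<tau> \<Longrightarrow> exec (Branch r P Q) \<sigma> \<tau>"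
| exec_While_False: "\<sigma> r = 0 \<Longrightarrow> exec (While r P) \<sigma> \<sigma>"
| exec_While_True: "\<sigma> r \<noteq> 0 \<Longrightarrow> exec P \<sigma> \<tau> \<Longrightarrow> exec (While r P) \<tau> \<rho> \<Longrightarrow> exec (While r P) \<sigma> \<rho>"

fun regs :: "prog \<Rightarrow> nat set" where
  "regs (Inc r) = {r}"
| "regs (Dec r) = {r}"
| "regs (Seq P Q) = regs P \<union> regs Q"
| "regs (Branch r P Q) = insert r (regs P \<union> regs Q)"
| "regs (While r P) = insert r (regs P)"

lemma finite_regs: "finite (regs P)"
  by (induction P) auto

text \<open>Number of machine states occupied. A program placed at \<open>s\<close> uses the states
  \<open>s\<close>, ..., \<open>s + len P - 1\<close> and is left by entering
  \<open>s + len P\<close>, so sequential composition needs no jump.\<close>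

fun len :: "prog \<Rightarrow> nat" where
  "len (Inc r) = 2"
| "len (Dec r) = 3"
| "len (Seq P Q) = len P + len Q"
| "len (Branch r P Q) = len P + len Q + 2"
| "len (While r P) = len P + 2"

text \<open>Every register is a block of ones on its own track of the tape, starting at cell \<open>0\<close>; a symbol
  codes the set of tracks that carry a one. Since cell \<open>-1\<close> is blank, a head that has left the
  origin along the track of a register finds its way back without any marker.\<close>

fun delta :: "prog \<Rightarrow> nat \<Rightarrow> nat \<Rightarrow> nat \<Rightarrow> nat \<times> nat \<times> direction" where
  "delta (Inc r) s q a =
     (if q = s then
        if r \<in> set_decode a then (s, a, Move_right)
        else (s + 1, set_encode (insert r (set_decode a)), Move_left)
      else
        if r \<in> set_decode a then (s + 1, a, Move_left) else (s + 2, a, Move_right))"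
| "delta (Dec r) s q a =
     (if q = s then
        if r \<in> set_decode a then (s, a, Move_right) else (s + 1, a, Move_left)
      else if q = s + 1 then
        if r \<in> set_decode a then (s + 2, set_encode (set_decode a - {r}), Move_left)
        else (s + 3, a, Move_right)
      else
        if r \<in> set_decode a then (s + 2, a, Move_left) else (s + 3, a, Move_right))"
| "delta (Seq P Q) s q a = (if q < s + len P then delta P s q a else delta Q (s + len P) q a)"
| "delta (Branch r P Q) s q a =
     (if q = s then
        if r \<in> set_decode a then (s + 1, a, Stay) else (s + len P + 2, a, Stay)
      else if q < s + 1 + len P then delta P (s + 1) q a
      else if q = s + 1 + len P then (s + len P + len Q + 2, a, Stay)
      else delta Q (s + len P + 2) q a)"
| "delta (While r P) s q a =
     (if q = s then
        if r \<in> set_decode a then (s + 1, a, Stay) else (s + len P + 2, a, Stay)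
      else if q < s + 1 + len P then delta P (s + 1) q a
      else (s, a, Stay))"

text \<open>A table over all symbols below \<open>2 ^ k\<close> covers every set of the first
  \<open>k\<close> tracks. The exit state \<open>len P\<close> has no entry, so finishing the
  program is halting.\<close>

definition tm_of :: "prog \<Rightarrow> nat \<Rightarrow> tm" where
  "tm_of P k = map (\<lambda>x. (x, delta P 0 (fst x) (snd x))) (List.product [0..<len P] [0..<2 ^ k])"

lemma map_of_tm_of:
  "map_of (tm_of P k) (q, a) = (if q < len P \<and> a < 2 ^ k then Some (delta P 0 q a) else None)"
  unfolding tm_of_def map_of_map_restrict by (auto simp: restrict_map_def)

text \<open>Refers to a block of states inside a larger table, so that it passes from a compound
  program to its parts.\<close>

definition implements :: "tm \<Rightarrow> nat \<Rightarrow> prog \<Rightarrow> nat \<Rightarrow> bool" where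
  "implements M k P s \<longleftrightarrow>
     (\<forall>q a. s \<le> q \<longrightarrow> q < s + len P \<longrightarrow> a < 2 ^ k \<longrightarrow> map_of M (q, a) = Some (delta P s q a))"

lemma implementsD:
  "implements M k P s \<Longrightarrow> s \<le> q \<Longrightarrow> q < s + len P \<Longrightarrow> a < 2 ^ k \<Longrightarrow> map_of M (q, a) = Some (delta P s q a)"
  by (simp add: implements_def)

section \<open>Runs of a machine and sweeps of its head\<close>

definition reaches :: "tm \<Rightarrow> tm_config \<Rightarrow> tm_config \<Rightarrow> bool" where
  "reaches M c c' \<longleftrightarrow> (\<exists>n. (tm_step M ^^ n) c = c')"

lemma reaches_refl: "reaches M c c"
  unfolding reaches_def by (rule exI[of _ 0]) simp

lemma reaches_trans: "reaches M a b \<Longrightarrow> reaches M b c \<Longrightarrow> reaches M a c"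
  unfolding reaches_def by (metis comp_apply funpow_add)

lemma reaches_step:
  assumes "map_of M (q, T p) = Some (q', b, D)" "reaches M (q', T(p := b), p + offset D) c"
  shows "reaches M (q, T, p) c"
proof (rule reaches_trans[OF _ assms(2)])
  show "reaches M (q, T, p) (q', T(p := b), p + offset D)"
    unfolding reaches_def using assms(1) by (intro exI[of _ 1]) simp
qed

lemma reaches_right:
  assumes "\<And>i. p \<le> i \<Longrightarrow> i < p + int n \<Longrightarrow> map_of M (q, T i) = Some (q, T i, Move_right)"
  shows "reaches M (q, T, p) (q, T, p + int n)"
  using assms
proof (induction n arbitrary: p)
  case (Suc n)
  have "reaches M (q, T, p + 1) (q, T, p + 1 + int n)"
    by (rule Suc.IH) (use Suc.prems in auto)
  then show ?case
    by (intro reaches_step[where T = T, OF Suc.prems[of p]]) (simp_all add: add.assoc)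
qed (simp add: reaches_refl)

lemma reaches_left:
  assumes "\<And>i. p - int n < i \<Longrightarrow> i \<le> p \<Longrightarrow> map_of M (q, T i) = Some (q, T i, Move_left)"
  shows "reaches M (q, T, p) (q, T, p - int n)"
  using assms
proof (induction n arbitrary: p)
  case (Suc n)
  have "reaches M (q, T, p - 1) (q, T, p - 1 - int n)"
    by (rule Suc.IH) (use Suc.prems in auto)
  then show ?case
    by (intro reaches_step[where T = T, OF Suc.prems[of p]]) (simp_all add: algebra_simps)
qed (simp add: reaches_refl)

section \<open>Register contents as tracks of a tape\<close>

definition tape :: "(nat \<Rightarrow> nat) \<Rightarrow> int \<Rightarrow> nat" where
  "tape \<sigma> i = (if i < 0 then 0 else set_encode {r. i < int (\<sigma> r)})"

definition supp_below :: "nat \<Rightarrow> (nat \<Rightarrow> nat) \<Rightarrow> bool" where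
  "supp_below k \<sigma> \<longleftrightarrow> (\<forall>r\<ge>k. \<sigma> r = 0)"

lemma supp_below_cell: "supp_below k \<sigma> \<Longrightarrow> 0 \<le> i \<Longrightarrow> {r. i < int (\<sigma> r)} \<subseteq> {..<k}"
proof
  fix r assume "supp_below k \<sigma>" "0 \<le> i" "r \<in> {r. i < int (\<sigma> r)}"
  then have "\<sigma> r \<noteq> 0" by auto
  with \<open>supp_below k \<sigma>\<close> show "r \<in> {..<k}"
    unfolding supp_below_def by (meson lessThan_iff not_le)
qed

lemma supp_below_finite: "supp_below k \<sigma> \<Longrightarrow> 0 \<le> i \<Longrightarrow> finite {r. i < int (\<sigma> r)}"
  by (rule finite_subset[OF supp_below_cell]) simp_all

lemma set_decode_tape:
  assumes "supp_below k \<sigma>"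
  shows "set_decode (tape \<sigma> i) = {r. 0 \<le> i \<and> i < int (\<sigma> r)}"
proof (cases "i < 0")
  case False
  then have "tape \<sigma> i = set_encode {r. i < int (\<sigma> r)}" "finite {r. i < int (\<sigma> r)}"
    using supp_below_finite[OF assms] by (auto simp: tape_def)
  then show ?thesis
    using False by (simp only: set_encode_inverse) auto
next
  case True
  then have "tape \<sigma> i = 0"
    by (simp only: tape_def if_True)
  with True show ?thesis
    by simp
qed

lemma set_encode_less:
  assumes "A \<subseteq> {..<k}"
  shows "set_encode A < 2 ^ k"
proof -
  have "set_encode A \<le> (\<Sum>i<k. 2 ^ i)"
    unfolding set_encode_def by (rule sum_mono2) (use assms in auto)
  also have "\<dots> < 2 ^ k"
    by (induction k) auto
  finally show ?thesis .
qed

lemma tape_less: "supp_below k \<sigma> \<Longrightarrow> tape \<sigma> i < 2 ^ k"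
  using supp_below_cell[of k \<sigma> i] set_encode_less by (simp add: tape_def)

lemma tape_Suc:
  assumes "supp_below k \<sigma>"
  shows "(tape \<sigma>)(int (\<sigma> r) := set_encode (insert r (set_decode (tape \<sigma> (int (\<sigma> r)))))) =
    tape (\<sigma>(r := Suc (\<sigma> r)))"
  unfolding set_decode_tape[OF assms]
  by (rule ext) (auto simp: tape_def intro!: arg_cong[where f = set_encode])

lemma tape_diff:
  assumes "supp_below k \<sigma>" "\<sigma> r = Suc n"
  shows "(tape \<sigma>)(int n := set_encode (set_decode (tape \<sigma> (int n)) - {r})) = tape (\<sigma>(r := n))"
  unfolding set_decode_tape[OF assms(1)] using assms(2)
  by (intro ext) (auto simp: tape_def intro!: arg_cong[where f = set_encode])

lemma exec_outside_regs: "exec P \<sigma> \<tau> \<Longrightarrow> r \<notin> regs P \<Longrightarrow> \<tau> r = \<sigma> r"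
  by (induction rule: exec.induct) auto

lemma exec_supp_below: "exec P \<sigma> \<tau> \<Longrightarrow> regs P \<subseteq> {..<k} \<Longrightarrow> supp_below k \<sigma> \<Longrightarrow> supp_below k \<tau>"
  unfolding supp_below_def using exec_outside_regs
  by (metis lessThan_iff linorder_not_le subsetD)

text \<open>Induction follows the derivation of \<open>exec\<close>, since a loop re-enters the same
  block of states; \<open>s\<close> varies because subprograms sit at other offsets. Between
  statements the head always rests on cell 0.\<close>

lemma exec_reaches:
  assumes "exec P \<sigma> \<tau>" "implements M k P s" "regs P \<subseteq> {..<k}" "supp_below k \<sigma>"
  shows "reaches M (s, tape \<sigma>, 0) (s + len P, tape \<tau>, 0)"
  using assms
proof (induction arbitrary: s rule: exec.induct)
  case (exec_Inc r \<sigma>)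
  note D = implementsD[OF exec_Inc.prems(1)] and [simp] = set_decode_tape[OF exec_Inc.prems(3)]
  let ?n = "int (\<sigma> r)"
  let ?\<tau> = "\<sigma>(r := Suc (\<sigma> r))"
  have sup: "supp_below k ?\<tau>"
    using exec_supp_below[OF exec.exec_Inc] exec_Inc.prems by blast
  note [simp] = set_decode_tape[OF sup]
  have 1: "reaches M (s, tape \<sigma>, 0) (s, tape \<sigma>, 0 + ?n)"
    by (rule reaches_right) (use D[of s] tape_less[OF exec_Inc.prems(3)] in auto)
  have 2: "map_of M (s, tape \<sigma> ?n) =
      Some (s + 1, set_encode (insert r (set_decode (tape \<sigma> ?n))), Move_left)"
    using D[of s] tape_less[OF exec_Inc.prems(3)] by auto
  have 3: "reaches M (s + 1, tape ?\<tau>, ?n - 1) (s + 1, tape ?\<tau>, ?n - 1 - ?n)"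
    by (rule reaches_left) (use D[of "s + 1"] tape_less[OF sup] in auto)
  have 4: "reaches M (s + 1, tape ?\<tau>, -1) (s + 2, tape ?\<tau>, 0)"
    by (rule reaches_step[where q' = "s + 2" and b = "tape ?\<tau> (-1)" and D = Move_right])
      (use D[of "s + 1"] tape_less[OF sup] in \<open>auto simp: reaches_refl\<close>)
  have "reaches M (s, tape \<sigma>, ?n) (s + 2, tape ?\<tau>, 0)"
    by (rule reaches_step[where T = "tape \<sigma>", OF 2], unfold tape_Suc[OF exec_Inc.prems(3)])
      (use reaches_trans[OF 3] 4 in simp)
  then show ?case
    using reaches_trans[OF 1] by (simp add: fun_upd_def)
next
  case (exec_Dec r \<sigma>)
  note sup = exec_Dec.prems(3)
  note D = implementsD[OF exec_Dec.prems(1)] and [simp] = set_decode_tape[OF sup]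
  let ?n = "int (\<sigma> r)"
  have 1: "reaches M (s, tape \<sigma>, 0) (s, tape \<sigma>, 0 + ?n)"
    by (rule reaches_right) (use D[of s] tape_less[OF sup] in auto)
  have 2: "reaches M (s, tape \<sigma>, ?n) (s + 1, tape \<sigma>, ?n - 1)"
    by (rule reaches_step[where q' = "s + 1" and b = "tape \<sigma> ?n" and D = Move_left])
      (use D[of s] tape_less[OF sup] in \<open>auto simp: reaches_refl\<close>)
  have 12: "reaches M (s, tape \<sigma>, 0) (s + 1, tape \<sigma>, ?n - 1)"
    using reaches_trans[OF 1] 2 by simp
  show ?case
  proof (cases "\<sigma> r")
    case 0
    \<comment> \<open>On an empty register the head has already stepped to cell -1 and finds nothing
      to erase; decrementing 0 leaves 0.\<close>
    have "reaches M (s + 1, tape \<sigma>, -1) (s + 3, tape \<sigma>, 0)"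
      by (rule reaches_step[where q' = "s + 3" and b = "tape \<sigma> (-1)" and D = Move_right])
        (use D[of "s + 1"] tape_less[OF sup] in \<open>auto simp: reaches_refl\<close>)
    moreover have "\<sigma>(r := \<sigma> r - 1) = \<sigma>"
      using 0 by auto
    ultimately show ?thesis
      using reaches_trans[OF 12] 0 by simp
  next
    case (Suc n)
    let ?\<tau> = "\<sigma>(r := n)"
    have sup': "supp_below k ?\<tau>"
      using sup Suc unfolding supp_below_def by auto
    note [simp] = set_decode_tape[OF sup']
    have 3: "map_of M (s + 1, tape \<sigma> (int n)) =
        Some (s + 2, set_encode (set_decode (tape \<sigma> (int n)) - {r}), Move_left)"
      using D[of "s + 1"] tape_less[OF sup] Suc by auto
    have 4: "reaches M (s + 2, tape ?\<tau>, int n - 1) (s + 2, tape ?\<tau>, int n - 1 - int n)"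
      by (rule reaches_left) (use D[of "s + 2"] tape_less[OF sup'] in auto)
    have 5: "reaches M (s + 2, tape ?\<tau>, -1) (s + 3, tape ?\<tau>, 0)"
      by (rule reaches_step[where q' = "s + 3" and b = "tape ?\<tau> (-1)" and D = Move_right])
        (use D[of "s + 2"] tape_less[OF sup'] in \<open>auto simp: reaches_refl\<close>)
    have "reaches M (s + 1, tape \<sigma>, int n) (s + 3, tape ?\<tau>, 0)"
      by (rule reaches_step[where T = "tape \<sigma>", OF 3], unfold tape_diff[OF sup Suc])
        (use reaches_trans[OF 4] 5 in simp)
    then show ?thesis
      using reaches_trans[OF 12] Suc by (simp add: fun_upd_def)
  qed
next
  case (exec_Seq P \<sigma> \<tau> Q \<rho>)
  have "implements M k P s" "implements M k Q (s + len P)"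
    using exec_Seq.prems(1) unfolding implements_def by auto
  moreover have "supp_below k \<tau>"
    using exec_supp_below[OF exec_Seq.hyps(1)] exec_Seq.prems by simp
  ultimately show ?case
    using exec_Seq.IH exec_Seq.prems reaches_trans by (simp add: add.assoc[symmetric]) blast
next
  case (exec_Branch_True \<sigma> r P \<tau> Q)
  note D = implementsD[OF exec_Branch_True.prems(1)]
  note sup = exec_Branch_True.prems(3)
  have 1: "reaches M (s, tape \<sigma>, 0) (s + 1, tape \<sigma>, 0)"
    by (rule reaches_step[where q' = "s + 1" and b = "tape \<sigma> 0" and D = Stay])
      (use D[of s] tape_less[OF sup] exec_Branch_True.hyps in
        \<open>auto simp: reaches_refl set_decode_tape[OF sup]\<close>)
  have "implements M k P (s + 1)"
    using exec_Branch_True.prems(1) unfolding implements_def by auto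
  then have 2: "reaches M (s + 1, tape \<sigma>, 0) (s + 1 + len P, tape \<tau>, 0)"
    by (rule exec_Branch_True.IH) (use exec_Branch_True.prems in auto)
  have sup': "supp_below k \<tau>"
    using exec_supp_below[OF exec_Branch_True.hyps(2)] exec_Branch_True.prems by simp
  have 3: "reaches M (s + 1 + len P, tape \<tau>, 0) (s + len P + len Q + 2, tape \<tau>, 0)"
    by (rule reaches_step[where q' = "s + len P + len Q + 2" and b = "tape \<tau> 0" and D = Stay])
      (use D[of "s + 1 + len P"] tape_less[OF sup'] in \<open>auto simp: reaches_refl\<close>)
  show ?case
    using reaches_trans[OF 1 reaches_trans[OF 2 3]] by (simp add: algebra_simps)
next
  case (exec_Branch_False \<sigma> r Q \<tau> P)
  note D = implementsD[OF exec_Branch_False.prems(1)]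
  note sup = exec_Branch_False.prems(3)
  have 1: "reaches M (s, tape \<sigma>, 0) (s + len P + 2, tape \<sigma>, 0)"
    by (rule reaches_step[where q' = "s + len P + 2" and b = "tape \<sigma> 0" and D = Stay])
      (use D[of s] tape_less[OF sup] exec_Branch_False.hyps in
        \<open>auto simp: reaches_refl set_decode_tape[OF sup]\<close>)
  have "implements M k Q (s + len P + 2)"
    using exec_Branch_False.prems(1) unfolding implements_def by auto
  then have 2: "reaches M (s + len P + 2, tape \<sigma>, 0) (s + len P + 2 + len Q, tape \<tau>, 0)"
    by (rule exec_Branch_False.IH) (use exec_Branch_False.prems in auto)
  show ?case
    using reaches_trans[OF 1 2] by (simp add: algebra_simps)
next
  case (exec_While_False \<sigma> r P)
  note D = implementsD[OF exec_While_False.prems(1)]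
  note sup = exec_While_False.prems(3)
  show ?case
    by (rule reaches_step[where q' = "s + len P + 2" and b = "tape \<sigma> 0" and D = Stay])
      (use D[of s] tape_less[OF sup] exec_While_False.hyps in
        \<open>auto simp: reaches_refl set_decode_tape[OF sup]\<close>)
next
  case (exec_While_True \<sigma> r P \<tau> \<rho>)
  note D = implementsD[OF exec_While_True.prems(1)]
  note sup = exec_While_True.prems(3)
  have 1: "reaches M (s, tape \<sigma>, 0) (s + 1, tape \<sigma>, 0)"
    by (rule reaches_step[where q' = "s + 1" and b = "tape \<sigma> 0" and D = Stay])
      (use D[of s] tape_less[OF sup] exec_While_True.hyps in
        \<open>auto simp: reaches_refl set_decode_tape[OF sup]\<close>)
  have "implements M k P (s + 1)"
    using exec_While_True.prems(1) unfolding implements_def by auto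
  then have 2: "reaches M (s + 1, tape \<sigma>, 0) (s + 1 + len P, tape \<tau>, 0)"
    by (rule exec_While_True.IH(1)) (use exec_While_True.prems in auto)
  have sup': "supp_below k \<tau>"
    using exec_supp_below[OF exec_While_True.hyps(2)] exec_While_True.prems by simp
  have 3: "reaches M (s + 1 + len P, tape \<tau>, 0) (s, tape \<tau>, 0)"
    by (rule reaches_step[where q' = s and b = "tape \<tau> 0" and D = Stay])
      (use D[of "s + 1 + len P"] tape_less[OF sup'] in \<open>auto simp: reaches_refl\<close>)
  have 4: "reaches M (s, tape \<tau>, 0) (s + len (While r P), tape \<rho>, 0)"
    using exec_While_True.IH(2) exec_While_True.prems sup' by simp
  show ?case
    by (rule reaches_trans[OF 1 reaches_trans[OF 2 reaches_trans[OF 3 4]]])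
qed

text \<open>The output block must consist of the symbol \<open>1 = set_encode {0}\<close>, hence the demand that all
  registers but \<open>0\<close> be empty at the end.\<close>

lemma tm_of_returns:
  assumes "exec P (\<lambda>r. if r = 0 then n else 0) (\<lambda>r. if r = 0 then y else 0)"
    and "insert 0 (regs P) \<subseteq> {..<k}"
  shows "tm_returns (tm_of P k) n y"
proof -
  let ?\<sigma> = "\<lambda>n r. if r = 0 then n else 0 :: nat"
  have tape: "tape (?\<sigma> n) = (\<lambda>i. if 0 \<le> i \<and> i < int n then 1 else 0)" for n
  proof
    fix i :: int
    show "tape (?\<sigma> n) i = (if 0 \<le> i \<and> i < int n then 1 else 0)"
    proof (cases "i < 0")
      case False
      then have eq: "{r. i < int (?\<sigma> n r)} = (if i < int n then {0} else {})"
        by auto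
      show ?thesis
        by (simp only: tape_def eq) (use False in simp)
    qed (simp add: tape_def)
  qed
  have "implements (tm_of P k) k P 0"
    by (simp add: implements_def map_of_tm_of)
  moreover have "supp_below k (?\<sigma> n)"
    using assms(2) by (auto simp: supp_below_def)
  ultimately have "reaches (tm_of P k) (0, tape (?\<sigma> n), 0) (0 + len P, tape (?\<sigma> y), 0)"
    using assms by (intro exec_reaches) auto
  then obtain t where "(tm_step (tm_of P k) ^^ t) (tm_initial n) = (len P, tape (?\<sigma> y), 0)"
    unfolding reaches_def tm_initial_def tape by auto
  then show ?thesis
    unfolding tm_returns_def by (intro exI[of _ t]) (auto simp: map_of_tm_of tape)
qed


section \<open>Primitive recursive functions\<close>

lemma exec_WhileI:
  assumes "\<And>i. i < n \<Longrightarrow> s i r \<noteq> 0" "\<And>i. i < n \<Longrightarrow> exec P (s i) (s (Suc i))"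
    and "s n r = 0" "\<sigma> = s 0" "\<tau> = s n"
  shows "exec (While r P) \<sigma> \<tau>"
proof -
  \<comment> \<open>\<open>k\<close> counts the iterations still to come, so the induction starts at
    the last test.\<close>
  have "exec (While r P) (s (n - k)) (s n)" if "k \<le> n" for k
    using that
  proof (induction k)
    case (Suc k)
    then have "Suc (n - Suc k) = n - k"
      by simp
    then show ?case
      using Suc exec_While_True assms(1,2)[of "n - Suc k"] by simp
  qed (simp add: exec_While_False assms)
  from this[of n] show ?thesis
    using assms by simp
qed

lemma exec_IncI: "\<tau> = \<sigma>(r := Suc (\<sigma> r)) \<Longrightarrow> exec (Inc r) \<sigma> \<tau>"
  using exec_Inc by simp

lemma exec_DecI: "\<tau> = \<sigma>(r := \<sigma> r - 1) \<Longrightarrow> exec (Dec r) \<sigma> \<tau>"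
  using exec_Dec by simp

definition zero :: "nat \<Rightarrow> prog" where
  "zero r = While r (Dec r)"

definition move :: "nat \<Rightarrow> nat \<Rightarrow> prog" where
  "move r a = While r (Seq (Dec r) (Inc a))"

definition move2 :: "nat \<Rightarrow> nat \<Rightarrow> nat \<Rightarrow> prog" where
  "move2 r a b = While r (Seq (Dec r) (Seq (Inc a) (Inc b)))"

definition copy :: "nat \<Rightarrow> nat \<Rightarrow> nat \<Rightarrow> prog" where
  "copy r a t = Seq (move2 r a t) (move t r)"

text \<open>The pair in \<open>r\<close> and \<open>r + 1\<close> walks through the Cantor
  enumeration from \<open>(0, 0)\<close>, one successor for each unit of the counter
  \<open>r + 2\<close>: along a diagonal, or to the start of the next one when the second component
  is exhausted.\<close>

definition unpair :: "nat \<Rightarrow> prog" where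
  "unpair r = Seq (move r (r + 2)) (While (r + 2) (Seq (Dec (r + 2)) (Seq (Inc r)
     (Branch (r + 1) (Dec (r + 1)) (move r (r + 1))))))"

text \<open>Evaluates \<open>prod_encode (a, b) = triangle (a + b) + a\<close>: after
  \<open>a\<close> is put into \<open>r\<close> and \<open>a + b\<close> into \<open>r + 2\<close>,
  the countdown adds \<open>a + b\<close>, ..., 1 to \<open>r\<close>. The emptied
  \<open>r + 1\<close> serves as scratch for copying.\<close>

definition enpair :: "nat \<Rightarrow> prog" where
  "enpair r = Seq (move2 (r + 1) r (r + 2))
     (While (r + 2) (Seq (copy (r + 2) r (r + 1)) (Dec (r + 2))))"

lemma exec_zero: "\<tau> = \<sigma>(r := 0) \<Longrightarrow> exec (zero r) \<sigma> \<tau>"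
  unfolding zero_def
  by (rule exec_WhileI[where n = "\<sigma> r" and s = "\<lambda>i. \<sigma>(r := \<sigma> r - i)"]) (auto intro!: exec_DecI)

lemma exec_move:
  assumes "r \<noteq> a" "\<tau> = \<sigma>(r := 0, a := \<sigma> a + \<sigma> r)"
  shows "exec (move r a) \<sigma> \<tau>"
  unfolding move_def
  by (rule exec_WhileI[where n = "\<sigma> r" and s = "\<lambda>i. \<sigma>(r := \<sigma> r - i, a := \<sigma> a + i)"])
    (use assms in \<open>auto intro!: exec_DecI exec_IncI exec_Seq[OF exec_DecI[OF refl]]\<close>)

lemma exec_move2:
  assumes "r \<noteq> a" "r \<noteq> b" "a \<noteq> b" "\<tau> = \<sigma>(r := 0, a := \<sigma> a + \<sigma> r, b := \<sigma> b + \<sigma> r)"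
  shows "exec (move2 r a b) \<sigma> \<tau>"
  unfolding move2_def
  by (rule exec_WhileI[where n = "\<sigma> r" and
        s = "\<lambda>i. \<sigma>(r := \<sigma> r - i, a := \<sigma> a + i, b := \<sigma> b + i)"])
    (use assms in \<open>auto intro!: exec_IncI exec_Seq[OF exec_DecI[OF refl]] exec_Seq[OF exec_IncI[OF refl]]\<close>)

lemma exec_copy:
  assumes "r \<noteq> a" "r \<noteq> t" "a \<noteq> t" "\<sigma> t = 0" "\<tau> = \<sigma>(a := \<sigma> a + \<sigma> r)"
  shows "exec (copy r a t) \<sigma> \<tau>"
  unfolding copy_def
  by (rule exec_Seq[OF exec_move2[OF _ _ _ refl] exec_move]) (use assms in auto)

definition pfst :: "nat \<Rightarrow> nat" where "pfst n = fst (prod_decode n)"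
definition psnd :: "nat \<Rightarrow> nat" where "psnd n = snd (prod_decode n)"

lemma pfst_prod_encode [simp]: "pfst (prod_encode (a, b)) = a"
  and psnd_prod_encode [simp]: "psnd (prod_encode (a, b)) = b"
  and prod_encode_pfst_psnd [simp]: "prod_encode (pfst n, psnd n) = n"
  by (simp_all add: pfst_def psnd_def)

lemma prod_decode_Suc:
  "prod_decode (Suc n) = (if psnd n = 0 then (0, Suc (pfst n)) else (Suc (pfst n), psnd n - 1))"
proof -
  have "Suc (prod_encode (a, b)) = prod_encode (if b = 0 then (0, Suc a) else (Suc a, b - 1))" for a b
    by (cases b) (simp_all add: prod_encode_def)
  from this[of "pfst n" "psnd n"] show ?thesis
    by (metis prod_encode_inverse prod_encode_pfst_psnd)
qed

lemma pfst_0 [simp]: "pfst 0 = 0" and psnd_0 [simp]: "psnd 0 = 0"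
  by (simp_all add: pfst_def psnd_def prod_decode_def prod_decode_aux.simps)

lemma pfst_Suc: "pfst (Suc n) = (if psnd n = 0 then 0 else Suc (pfst n))"
  and psnd_Suc: "psnd (Suc n) = (if psnd n = 0 then Suc (pfst n) else psnd n - 1)"
  by (simp_all add: pfst_def[of "Suc n"] psnd_def[of "Suc n"] prod_decode_Suc)

lemma exec_unpair:
  assumes "\<sigma> (r + 1) = 0" "\<sigma> (r + 2) = 0" "\<tau> = \<sigma>(r := pfst (\<sigma> r), r + 1 := psnd (\<sigma> r))"
  shows "exec (unpair r) \<sigma> \<tau>"
proof -
  let ?x = "\<sigma> r"
  let ?s = "\<lambda>i. \<sigma>(r := pfst i, r + 1 := psnd i, r + 2 := ?x - i)"
  have "exec (Seq (Dec (r + 2)) (Seq (Inc r) (Branch (r + 1) (Dec (r + 1)) (move r (r + 1)))))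
      (?s i) (?s (Suc i))" if "i < ?x" for i
  proof (rule exec_Seq[OF exec_DecI[OF refl]], rule exec_Seq[OF exec_IncI[OF refl]])
    show "exec (Branch (r + 1) (Dec (r + 1)) (move r (r + 1)))
      ((?s i)(r + 2 := ?s i (r + 2) - 1, r := Suc (((?s i)(r + 2 := ?s i (r + 2) - 1)) r)) ) (?s (Suc i))"
    proof (cases "psnd i = 0")
      case True
      then show ?thesis
        by (intro exec_Branch_False exec_move) (auto simp: pfst_Suc psnd_Suc)
    next
      case False
      then show ?thesis
        by (intro exec_Branch_True exec_DecI) (auto simp: pfst_Suc psnd_Suc)
    qed
  qed
  then have loop: "exec (While (r + 2) (Seq (Dec (r + 2)) (Seq (Inc r)
     (Branch (r + 1) (Dec (r + 1)) (move r (r + 1)))))) (?s 0) (?s ?x)"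
    by (intro exec_WhileI[where n = ?x and s = ?s]) auto
  have init: "exec (move r (r + 2)) \<sigma> (?s 0)"
    by (intro exec_move) (use assms in auto)
  have "?s ?x = \<tau>"
    using assms by auto
  then show ?thesis
    unfolding unpair_def using exec_Seq[OF init loop] by simp
qed

lemma exec_enpair:
  assumes "\<sigma> r = 0"
    and "\<tau> = \<sigma>(r := prod_encode (\<sigma> (r + 1), \<sigma> (r + 2)), r + 1 := 0, r + 2 := 0)"
  shows "exec (enpair r) \<sigma> \<tau>"
proof -
  let ?a = "\<sigma> (r + 1)" and ?b = "\<sigma> (r + 2)"
  let ?n = "?a + ?b"
  let ?s = "\<lambda>i. \<sigma>(r := ?a + (triangle ?n - triangle (?n - i)), r + 1 := 0, r + 2 := ?n - i)"
  \<comment> \<open>Subtraction is truncated here, so the telescoping needs \<open>triangle\<close>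
    to be monotone.\<close>
  have tri: "triangle ?n - triangle (?n - Suc i) = triangle ?n - triangle (?n - i) + (?n - i)"
    if "i < ?n" for i
  proof -
    have mono: "triangle j \<le> triangle k" if "j \<le> k" for j k
      using that by (induction rule: dec_induct) auto
    have "?n - i = Suc (?n - Suc i)"
      using that by simp
    then have "triangle (?n - i) = triangle (?n - Suc i) + (?n - i)"
      using triangle_Suc by metis
    then show ?thesis
      using mono[of "?n - i" ?n] by simp
  qed
  have "exec (Seq (copy (r + 2) r (r + 1)) (Dec (r + 2))) (?s i) (?s (Suc i))" if "i < ?n" for i
    by (rule exec_Seq[OF exec_copy[OF _ _ _ _ refl] exec_DecI])
      (use tri[OF that] in \<open>auto simp: fun_upd_def\<close>)
  then have loop: "exec (While (r + 2) (Seq (copy (r + 2) r (r + 1)) (Dec (r + 2)))) (?s 0) (?s ?n)"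
    by (intro exec_WhileI[where n = ?n and s = ?s]) auto
  have init: "exec (move2 (r + 1) r (r + 2)) \<sigma> (?s 0)"
    by (intro exec_move2) (use assms in auto)
  have "?s ?n = \<tau>"
    using assms by (auto simp: prod_encode_def)
  then show ?thesis
    unfolding enpair_def using exec_Seq[OF init loop] by simp
qed


text \<open>Several arguments are packed into one by Cantor pairing, and iteration replaces
  recursion. Each function then acts on one number and can be compiled to a program that works in
  place on one register.\<close>

inductive pr :: "(nat \<Rightarrow> nat) \<Rightarrow> bool" where
  pr_id: "pr (\<lambda>x. x)"
| pr_zero: "pr (\<lambda>x. 0)"
| pr_succ: "pr Suc"
| pr_fst: "pr pfst"
| pr_snd: "pr psnd"
| pr_comp: "pr f \<Longrightarrow> pr g \<Longrightarrow> pr (\<lambda>x. f (g x))"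
| pr_pair: "pr f \<Longrightarrow> pr g \<Longrightarrow> pr (\<lambda>x. prod_encode (f x, g x))"
| pr_funpow: "pr h \<Longrightarrow> pr (\<lambda>x. (h ^^ pfst x) (psnd x))"

text \<open>The registers above \<open>r\<close> serve as a stack of blank scratch space.\<close>

lemma pr_program:
  "pr f \<Longrightarrow> \<exists>P. \<forall>\<sigma>. (\<forall>i>r. \<sigma> i = 0) \<longrightarrow> exec P \<sigma> (\<sigma>(r := f (\<sigma> r)))"
proof (induction arbitrary: r rule: pr.induct)
  case pr_id
  show ?case
    by (rule exI[of _ "Seq (Inc r) (Dec r)"]) (auto intro!: exec_Seq[OF exec_IncI[OF refl]] exec_DecI)
next
  case pr_zero
  show ?case
    by (rule exI[of _ "zero r"]) (auto intro!: exec_zero)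
next
  case pr_succ
  show ?case
    by (rule exI[of _ "Inc r"]) (auto intro!: exec_IncI)
next
  case pr_fst
  show ?case
    by (rule exI[of _ "Seq (unpair r) (zero (r + 1))"])
      (auto intro!: exec_Seq[OF exec_unpair[OF _ _ refl]] exec_zero)
next
  case pr_snd
  show ?case
    by (rule exI[of _ "Seq (unpair r) (Seq (zero r) (move (r + 1) r))"])
      (auto intro!: exec_Seq[OF exec_unpair[OF _ _ refl]] exec_Seq[OF exec_zero[OF refl]] exec_move)
next
  case (pr_comp f g)
  obtain P Q where P: "\<And>\<sigma>. (\<forall>i>r. \<sigma> i = 0) \<Longrightarrow> exec P \<sigma> (\<sigma>(r := f (\<sigma> r)))"
    and Q: "\<And>\<sigma>. (\<forall>i>r. \<sigma> i = 0) \<Longrightarrow> exec Q \<sigma> (\<sigma>(r := g (\<sigma> r)))"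
    using pr_comp.IH by metis
  have "exec (Seq Q P) \<sigma> (\<sigma>(r := f (g (\<sigma> r))))" if "\<forall>i>r. \<sigma> i = 0" for \<sigma>
    using exec_Seq[OF Q[OF that] P] that by simp
  then show ?case
    by blast
next
  case (pr_pair f g)
  obtain P Q where P: "\<And>\<sigma>. (\<forall>i>r+1. \<sigma> i = 0) \<Longrightarrow> exec P \<sigma> (\<sigma>(r+1 := f (\<sigma> (r+1))))"
    and Q: "\<And>\<sigma>. (\<forall>i>r+2. \<sigma> i = 0) \<Longrightarrow> exec Q \<sigma> (\<sigma>(r+2 := g (\<sigma> (r+2))))"
    using pr_pair.IH by metis
  \<comment> \<open>Programs overwrite their argument, so the input is kept in \<open>r\<close> and
    copied twice; \<open>f\<close> is computed in \<open>r + 1\<close> and \<open>g\<close> in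
    \<open>r + 2\<close>, above the first result.\<close>
  have "exec (Seq (copy r (r+1) (r+2)) (Seq P (Seq (copy r (r+2) (r+3)) (Seq Q
      (Seq (zero r) (enpair r)))))) \<sigma> (\<sigma>(r := prod_encode (f (\<sigma> r), g (\<sigma> r))))"
    if 0: "\<forall>i>r. \<sigma> i = 0" for \<sigma>
  proof -
    let ?x = "\<sigma> r"
    have 1: "exec (copy r (r+1) (r+2)) \<sigma> (\<sigma>(r+1 := ?x))"
      by (rule exec_copy) (use 0 in auto)
    have 2: "exec P (\<sigma>(r+1 := ?x)) (\<sigma>(r+1 := f ?x))"
      using P[of "\<sigma>(r+1 := ?x)"] 0 by simp
    have 3: "exec (copy r (r+2) (r+3)) (\<sigma>(r+1 := f ?x)) (\<sigma>(r+1 := f ?x, r+2 := ?x))"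
      by (rule exec_copy) (use 0 in auto)
    have 4: "exec Q (\<sigma>(r+1 := f ?x, r+2 := ?x)) (\<sigma>(r+1 := f ?x, r+2 := g ?x))"
      using Q[of "\<sigma>(r+1 := f ?x, r+2 := ?x)"] 0 by simp
    have 5: "exec (zero r) (\<sigma>(r+1 := f ?x, r+2 := g ?x)) (\<sigma>(r+1 := f ?x, r+2 := g ?x, r := 0))"
      by (rule exec_zero) simp
    have 6: "exec (enpair r) (\<sigma>(r+1 := f ?x, r+2 := g ?x, r := 0)) (\<sigma>(r := prod_encode (f ?x, g ?x)))"
      by (rule exec_enpair) (use 0 in auto)
    show ?thesis
      by (rule exec_Seq[OF 1 exec_Seq[OF 2 exec_Seq[OF 3 exec_Seq[OF 4 exec_Seq[OF 5 6]]]]])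
  qed
  then show ?case
    by blast
next
  case (pr_funpow h)
  obtain P where P: "\<And>\<sigma>. (\<forall>i>r+1. \<sigma> i = 0) \<Longrightarrow> exec P \<sigma> (\<sigma>(r+1 := h (\<sigma> (r+1))))"
    using pr_funpow.IH by metis
  have "exec (Seq (unpair r) (Seq (While r (Seq P (Dec r))) (move (r+1) r))) \<sigma>
      (\<sigma>(r := (h ^^ pfst (\<sigma> r)) (psnd (\<sigma> r))))"
    if 0: "\<forall>i>r. \<sigma> i = 0" for \<sigma>
  proof -
    let ?n = "pfst (\<sigma> r)" and ?y = "psnd (\<sigma> r)"
    let ?s = "\<lambda>i. \<sigma>(r := ?n - i, r+1 := (h ^^ i) ?y)"
    have 1: "exec (unpair r) \<sigma> (?s 0)"
      by (rule exec_unpair) (use 0 in auto)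
    have "exec (Seq P (Dec r)) (?s i) (?s (Suc i))" for i
      by (rule exec_Seq[OF P exec_DecI]) (use 0 in \<open>auto simp: fun_upd_def\<close>)
    then have 2: "exec (While r (Seq P (Dec r))) (?s 0) (?s ?n)"
      by (intro exec_WhileI[where n = ?n and s = ?s]) auto
    have 3: "exec (move (r+1) r) (?s ?n) (\<sigma>(r := (h ^^ ?n) ?y))"
      by (rule exec_move) (use 0 in auto)
    show ?thesis
      by (rule exec_Seq[OF 1 exec_Seq[OF 2 3]])
  qed
  then show ?case
    by blast
qed

lemma pr_Suc: "pr f \<Longrightarrow> pr (\<lambda>x. Suc (f x))"
  by (rule pr_comp[OF pr_succ])

lemma pr_pfst: "pr f \<Longrightarrow> pr (\<lambda>x. pfst (f x))"
  by (rule pr_comp[OF pr_fst])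

lemma pr_psnd: "pr f \<Longrightarrow> pr (\<lambda>x. psnd (f x))"
  by (rule pr_comp[OF pr_snd])

lemma pr_const: "pr (\<lambda>x. c)"
  by (induction c) (auto intro: pr_zero pr_Suc)

text \<open>The minimisation of Kleene's normal form. One machine serves all \<open>x\<close>, and
  nothing is claimed where no zero exists.\<close>

theorem tm_search:
  assumes "pr q" "pr u"
  shows "\<exists>E. \<forall>x. (\<exists>y. q (prod_encode (x, y)) = 0) \<longrightarrow>
           tm_returns E x (u (prod_encode (x, LEAST y. q (prod_encode (x, y)) = 0)))"
proof -
  have prog: "\<exists>P. \<forall>\<sigma>. (\<forall>i>r. \<sigma> i = 0) \<longrightarrow> exec P \<sigma> (\<sigma>(r := f (\<sigma> r)))" if "pr f" for r f
    using pr_program[OF that] .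
  obtain I where I: "\<And>\<sigma>. (\<forall>i>0. \<sigma> i = 0) \<Longrightarrow> exec I \<sigma> (\<sigma>(0 := prod_encode (\<sigma> 0, 0)))"
    using prog[OF pr_pair[OF pr_id pr_zero], of 0] by auto
  obtain S where S: "\<And>\<sigma>. (\<forall>i>0. \<sigma> i = 0) \<Longrightarrow>
      exec S \<sigma> (\<sigma>(0 := prod_encode (pfst (\<sigma> 0), Suc (psnd (\<sigma> 0)))))"
    using prog[OF pr_pair[OF pr_fst pr_Suc[OF pr_snd]], of 0] by auto
  obtain Q where Q: "\<And>\<sigma>. (\<forall>i>1. \<sigma> i = 0) \<Longrightarrow> exec Q \<sigma> (\<sigma>(1 := q (\<sigma> 1)))"
    using prog[OF assms(1), of 1] by auto
  obtain U where U: "\<And>\<sigma>. (\<forall>i>0. \<sigma> i = 0) \<Longrightarrow> exec U \<sigma> (\<sigma>(0 := u (\<sigma> 0)))"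
    using prog[OF assms(2), of 0] by auto
  \<comment> \<open>Register 0 holds the pair of \<open>x\<close> and the current \<open>y\<close>,
    register 1 the test value. The loop ends when register 1 is empty, so the result stands alone in
    register 0, as the output convention requires.\<close>
  define E where "E = Seq I (Seq (copy 0 1 2) (Seq Q
    (Seq (While 1 (Seq (zero 1) (Seq S (Seq (copy 0 1 2) Q)))) U)))"
  define k where "k = Suc (Max (insert 0 (regs E)))"
  have k: "insert 0 (regs E) \<subseteq> {..<k}"
    using finite_regs[of E] by (auto simp: k_def less_Suc_eq_le)
  have "tm_returns (tm_of E k) x (u (prod_encode (x, LEAST y. q (prod_encode (x, y)) = 0)))"
    if ex: "\<exists>y. q (prod_encode (x, y)) = 0" for x
  proof (rule tm_of_returns[OF _ k])
    define n where "n = (LEAST y. q (prod_encode (x, y)) = 0)"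
    have n: "q (prod_encode (x, n)) = 0"
      unfolding n_def using ex by (rule LeastI_ex)
    have less: "q (prod_encode (x, i)) \<noteq> 0" if "i < n" for i
      using not_less_Least that unfolding n_def by blast
    let ?z = "\<lambda>i. prod_encode (x, i)"
    let ?t = "\<lambda>i. (\<lambda>r::nat. 0)(0 := ?z i)"
    let ?s = "\<lambda>i. (\<lambda>r::nat. 0)(0 := ?z i, 1 := q (?z i))"
    let ?\<sigma> = "\<lambda>n r. if r = 0 then n else 0 :: nat"
    have test: "exec (copy 0 1 2) (?t i) ((?t i)(1 := ?z i))"
      "exec Q ((?t i)(1 := ?z i)) (?s i)" for i
      using Q[of "(?t i)(1 := ?z i)"] by (auto intro!: exec_copy)
    have "exec (Seq (zero 1) (Seq S (Seq (copy 0 1 2) Q))) (?s i) (?s (Suc i))" for i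
    proof -
      have 1: "exec (zero 1) (?s i) (?t i)"
        by (rule exec_zero) auto
      have 2: "exec S (?t i) (?t (Suc i))"
        using S[of "?t i"] by simp
      show ?thesis
        by (rule exec_Seq[OF 1 exec_Seq[OF 2 exec_Seq[OF test]]])
    qed
    then have loop: "exec (While 1 (Seq (zero 1) (Seq S (Seq (copy 0 1 2) Q)))) (?s 0) (?s n)"
      using less n by (intro exec_WhileI[where n = n and s = ?s]) auto
    have "?s n = ?t n"
      using n by (auto simp: fun_eq_iff)
    moreover have "(?t n)(0 := u (?z n)) = ?\<sigma> (u (?z n))" "(?\<sigma> x)(0 := ?z 0) = ?t 0"
      by auto
    ultimately have last: "exec U (?s n) (?\<sigma> (u (?z n)))" and first: "exec I (?\<sigma> x) (?t 0)"
      using U[of "?t n"] I[of "?\<sigma> x"] by simp_all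
    show "exec E (?\<sigma> x) (?\<sigma> (u (prod_encode (x, LEAST y. q (prod_encode (x, y)) = 0))))"
      unfolding E_def n_def[symmetric]
      by (rule exec_Seq[OF first exec_Seq[OF test(1) exec_Seq[OF test(2) exec_Seq[OF loop last]]]])
  qed
  then show ?thesis
    by blast
qed


section \<open>Closure properties of primitive recursion\<close>

named_theorems pr_intros

lemmas [pr_intros] = pr_id pr_const pr_Suc pr_pfst pr_psnd pr_pair

lemma pr_cong:
  assumes "\<And>x. f x = g x" "pr g"
  shows "pr f"
proof -
  have "f = g"
    using assms(1) by (rule ext)
  then show ?thesis
    using assms(2) by simp
qed

text \<open>Reduces a curried operation to the projections of one argument, where the closure rules
  suffice and no facts about the operands enter.\<close>

lemma pr_comp2:
  assumes "pr (\<lambda>z. F (pfst z) (psnd z))" "pr f" "pr g"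
  shows "pr (\<lambda>x. F (f x) (g x))"
  using pr_comp[OF assms(1) pr_pair[OF assms(2,3)]] by simp

lemma pr_comp3:
  assumes "pr (\<lambda>z. F (pfst z) (pfst (psnd z)) (psnd (psnd z)))" "pr f" "pr g" "pr h"
  shows "pr (\<lambda>x. F (f x) (g x) (h x))"
  using pr_comp[OF assms(1) pr_pair[OF assms(2) pr_pair[OF assms(3,4)]]] by simp

text \<open>Basic iteration has no parameter; here \<open>x\<close> travels unchanged in the first
  component of the iterated pair.\<close>

lemma pr_iterate [pr_intros]:
  assumes "pr f" "pr g" "pr (\<lambda>z. h (pfst z) (psnd z))"
  shows "pr (\<lambda>x. (h x ^^ f x) (g x))"
proof -
  let ?H = "\<lambda>z. prod_encode (pfst z, h (pfst z) (psnd z))"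
  have "pr (\<lambda>z. (?H ^^ pfst z) (psnd z))"
    by (intro pr_funpow pr_pair pr_pfst pr_id assms)
  from pr_comp[OF this pr_pair[OF assms(1) pr_pair[OF pr_id assms(2)]]]
  have "pr (\<lambda>x. psnd ((?H ^^ f x) (prod_encode (x, g x))))"
    by (intro pr_psnd) simp
  moreover have "(?H ^^ n) (prod_encode (x, a)) = prod_encode (x, (h x ^^ n) a)" for n x a
    by (induction n) auto
  ultimately show ?thesis
    by simp
qed

text \<open>Iteration does not know its stage, so the iterated pair carries the counter of the
  recursion.\<close>

lemma pr_rec_nat [pr_intros]:
  assumes "pr f" "pr g" "pr (\<lambda>z. h (pfst z) (pfst (psnd z)) (psnd (psnd z)))"
  shows "pr (\<lambda>x. rec_nat (g x) (h x) (f x))"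
proof -
  let ?H = "\<lambda>x z. prod_encode (Suc (pfst z), h x (pfst z) (psnd z))"
  have "pr (\<lambda>x. psnd ((?H x ^^ f x) (prod_encode (0, g x))))"
    by (intro pr_psnd pr_iterate pr_pair pr_const pr_Suc pr_pfst pr_id assms)
  moreover have "(?H x ^^ n) (prod_encode (0, a)) = prod_encode (n, rec_nat a (h x) n)" for x n a
    by (induction n) auto
  ultimately show ?thesis
    by simp
qed

lemma pr_add [pr_intros]:
  assumes "pr f" "pr g"
  shows "pr (\<lambda>x. f x + g x)"
proof -
  have "a + b = rec_nat a (\<lambda>n c. Suc c) b" for a b
    by (induction b) auto
  from this[of "f x" "g x" for x] show ?thesis
    by (rule pr_cong) (intro pr_intros assms)
qed

lemma pr_mult [pr_intros]:
  assumes "pr f" "pr g"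
  shows "pr (\<lambda>x. f x * g x)"
proof -
  have "a * b = rec_nat 0 (\<lambda>n c. c + a) b" for a b
    by (induction b) auto
  from this[of "pfst z" "psnd z" for z] have "pr (\<lambda>z. pfst z * psnd z)"
    by (rule pr_cong) (intro pr_intros)
  from pr_comp2[OF this assms] show ?thesis .
qed

lemma pr_power [pr_intros]:
  assumes "pr f" "pr g"
  shows "pr (\<lambda>x. f x ^ g x)"
proof -
  have "a ^ b = rec_nat 1 (\<lambda>n c. c * a) b" for a b :: nat
    by (induction b) auto
  from this[of "pfst z" "psnd z" for z] have "pr (\<lambda>z. pfst z ^ psnd z)"
    by (rule pr_cong) (intro pr_intros)
  from pr_comp2[OF this assms] show ?thesis .
qed

lemma pr_diff [pr_intros]:
  assumes "pr f" "pr g"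
  shows "pr (\<lambda>x. f x - g x)"
proof -
  have "n - 1 = rec_nat 0 (\<lambda>n c. n) n" for n :: nat
    by (induction n) auto
  then have "pr (\<lambda>z. z - 1)"
    by (rule pr_cong) (intro pr_intros)
  then have *: "pr (\<lambda>z. psnd (psnd z) - 1)"
    by (rule pr_comp) (intro pr_intros)
  have "a - b = rec_nat a (\<lambda>n c. c - 1) b" for a b :: nat
    by (induction b) auto
  from this[of "f x" "g x" for x] show ?thesis
    by (rule pr_cong) (intro pr_intros assms *)
qed

abbreviation prp :: "(nat \<Rightarrow> bool) \<Rightarrow> bool" where
  "prp P \<equiv> pr (\<lambda>x. of_bool (P x))"

lemma prp_le [pr_intros]: "pr f \<Longrightarrow> pr g \<Longrightarrow> prp (\<lambda>x. f x \<le> g x)"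
proof -
  assume *: "pr f" "pr g"
  have "of_bool (f x \<le> g x) = 1 - (f x - g x)" for x
    by auto
  then show ?thesis
    by (rule pr_cong) (intro pr_intros *)
qed

lemma prp_less [pr_intros]: "pr f \<Longrightarrow> pr g \<Longrightarrow> prp (\<lambda>x. f x < g x)"
  unfolding Suc_le_eq[symmetric] by (intro pr_intros)

lemma prp_conj [pr_intros]: "prp P \<Longrightarrow> prp Q \<Longrightarrow> prp (\<lambda>x. P x \<and> Q x)"
  unfolding of_bool_conj by (intro pr_intros)

lemma prp_not [pr_intros]: "prp P \<Longrightarrow> prp (\<lambda>x. \<not> P x)"
proof -
  assume *: "prp P"
  have "of_bool (\<not> P x) = 1 - (of_bool (P x) :: nat)" for x
    by auto
  then show ?thesis
    by (rule pr_cong) (intro pr_intros *)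
qed

lemma prp_imp [pr_intros]: "prp P \<Longrightarrow> prp Q \<Longrightarrow> prp (\<lambda>x. P x \<longrightarrow> Q x)"
proof -
  assume *: "prp P" "prp Q"
  have "of_bool (P x \<longrightarrow> Q x) = (of_bool (\<not> (P x \<and> \<not> Q x)) :: nat)" for x
    by auto
  then show ?thesis
    by (rule pr_cong) (intro pr_intros *)
qed

lemma prp_eq [pr_intros]: "pr f \<Longrightarrow> pr g \<Longrightarrow> prp (\<lambda>x. f x = g x)"
  unfolding eq_iff by (intro pr_intros)

lemma pr_if [pr_intros]:
  assumes "prp P" "pr f" "pr g"
  shows "pr (\<lambda>x. if P x then f x else g x)"
proof -
  have "(if P x then f x else g x) = of_bool (P x) * f x + of_bool (\<not> P x) * g x" for x
    by auto
  then show ?thesis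
    by (rule pr_cong) (intro pr_intros assms)
qed

lemma pr_Let [pr_intros]:
  "pr f \<Longrightarrow> pr (\<lambda>z. g (pfst z) (psnd z)) \<Longrightarrow> pr (\<lambda>x. let y = f x in g x y)"
  unfolding Let_def by (rule pr_comp2[of g, OF _ pr_id])

lemma pr_sum [pr_intros]:
  assumes "pr f" "pr (\<lambda>z. g (pfst z) (psnd z))"
  shows "pr (\<lambda>x. \<Sum>i<f x. g x i)"
proof -
  have eq: "(\<Sum>i<n. g x i) = rec_nat 0 (\<lambda>i a. a + g x i) n" for x n
    by (induction n) auto
  have [pr_intros]: "pr (\<lambda>z. g (pfst z) (pfst (psnd z)))"
    by (rule pr_comp2[OF assms(2)]) (intro pr_intros)+
  show ?thesis
    unfolding eq by (intro pr_intros assms)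
qed

lemma prp_all_less [pr_intros]:
  assumes "pr f" "prp (\<lambda>z. P (pfst z) (psnd z))"
  shows "prp (\<lambda>x. \<forall>i<f x. P x i)"
proof -
  have "of_bool (\<forall>i<f x. P x i) = (of_bool ((\<Sum>i<f x. of_bool (\<not> P x i)) = (0::nat)) :: nat)" for x
    by auto
  then show ?thesis
    by (rule pr_cong) (intro pr_intros assms)
qed

lemma pr_div [pr_intros]:
  assumes "pr f" "pr g"
  shows "pr (\<lambda>x. f x div g x)"
proof -
  \<comment> \<open>The quotient is the number of positive multiples of \<open>b\<close> that do not
    exceed \<open>a\<close>; division by 0 yields 0.\<close>
  have "a div b = (if b = 0 then 0 else \<Sum>i<a. of_bool (Suc i * b \<le> a))" for a b :: nat
  proof (cases "b = 0")
    case False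
    then have "Suc i * b \<le> a \<longleftrightarrow> i < a div b" for i
      by (metis Suc_le_eq less_eq_div_iff_mult_less_eq neq0_conv)
    moreover have "i < a" if "i < a div b" for i
      using that div_le_dividend[of a b] by linarith
    ultimately have "{i \<in> {..<a}. Suc i * b \<le> a} = {..<a div b}"
      by (simp only: set_eq_iff mem_Collect_eq lessThan_iff) blast
    then have "card {i \<in> {..<a}. Suc i * b \<le> a} = a div b"
      by simp
    then show ?thesis
      using False by (simp add: sum_of_bool_eq Int_def del: mult_Suc)
  qed simp
  from this[of "pfst z" "psnd z" for z] have "pr (\<lambda>z. pfst z div psnd z)"
    by (rule pr_cong) (intro pr_intros)
  from pr_comp2[OF this assms] show ?thesis .
qed

lemma prp_set_decode [pr_intros]:
  assumes "pr f" "pr g"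
  shows "prp (\<lambda>x. f x \<in> set_decode (g x))"
proof -
  \<comment> \<open>Membership is a binary digit: divide by a power of 2 and take the remainder
    modulo 2, expressed through division.\<close>
  have "of_bool (f x \<in> set_decode (g x)) =
      (of_bool (g x div 2 ^ f x - 2 * (g x div 2 ^ f x div 2) = 1) :: nat)" for x
    unfolding minus_mult_div_eq_mod by (simp add: set_decode_def odd_iff_mod_2_eq_one)
  then show ?thesis
    by (rule pr_cong) (intro pr_intros assms)
qed

lemma pr_foldl [pr_intros]:
  assumes "pr l" "pr g" "pr (\<lambda>z. h (pfst z) (pfst (psnd z)) (psnd (psnd z)))"
  shows "pr (\<lambda>x. foldl (h x) (g x) (list_decode (l x)))"
proof -
  define H where "H x s = (if psnd s = 0 then s else
    prod_encode (h x (pfst s) (pfst (psnd s - 1)), psnd (psnd s - 1)))" for x s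
  have "(H x ^^ n) (prod_encode (a, list_encode ys)) = prod_encode (foldl (h x) a ys, 0)"
    if "length ys \<le> n" for x n a ys
    using that
  proof (induction n arbitrary: a ys)
    case (Suc n)
    have *: "(H x ^^ Suc n) s = (H x ^^ n) (H x s)" for s
      by (simp only: funpow_Suc_right comp_apply)
    show ?case
    proof (cases ys)
      case Nil
      then have "H x (prod_encode (a, list_encode ys)) = prod_encode (a, list_encode [])"
        by (simp add: H_def)
      then show ?thesis
        using Suc.IH[of "[]" a] Nil unfolding * by simp
    next
      case (Cons y zs)
      then have "H x (prod_encode (a, list_encode ys)) = prod_encode (h x a y, list_encode zs)"
        by (simp add: H_def)
      then show ?thesis
        using Suc.IH[of zs "h x a y"] Suc.prems Cons unfolding * by simp
    qed
  qed simp
  \<comment> \<open>Each list cell adds \<open>Suc\<close> to a pair code that bounds the code of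
    the tail, so the code bounds the length.\<close>
  moreover have "length (list_decode n) \<le> n" for n
  proof (induction n rule: list_decode.induct)
    case (2 n)
    obtain a b where ab: "prod_decode n = (a, b)"
      by fastforce
    then have "b \<le> n"
      using le_prod_encode_2[of b a] by (metis prod_decode_inverse)
    with 2 ab show ?case
      by fastforce
  qed simp
  ultimately have eq: "foldl (h x) (g x) (list_decode (l x)) =
      pfst ((H x ^^ l x) (prod_encode (g x, l x)))" for x
    by (metis list_decode_inverse pfst_prod_encode)
  have "pr (\<lambda>z. h (pfst z) (pfst (psnd z)) (pfst (psnd (psnd z) - 1)))"
    by (rule pr_comp3[OF assms(3)]) (intro pr_intros)+
  then have "pr (\<lambda>z. H (pfst z) (psnd z))"
    unfolding H_def by (intro pr_intros)
  then show ?thesis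
    by (intro pr_cong[OF eq] pr_intros assms)
qed

lemma pr_length [pr_intros]:
  assumes "pr l"
  shows "pr (\<lambda>x. length (list_decode (l x)))"
proof -
  have "length xs + n = foldl (\<lambda>a y. Suc a) n xs" for xs :: "nat list" and n
    by (induction xs arbitrary: n) (auto, metis add_Suc_right)
  from this[where n = 0] have
    "length (list_decode (l x)) = foldl (\<lambda>a y. Suc a) 0 (list_decode (l x))" for x
    by (metis add_0_right)
  then show ?thesis
    by (rule pr_cong) (intro pr_intros assms)
qed

lemma prp_Ball_list [pr_intros]:
  assumes "pr l" "prp (\<lambda>z. P (pfst z) (psnd z))"
  shows "prp (\<lambda>x. \<forall>y\<in>set (list_decode (l x)). P x y)"
proof -
  have "foldl (\<lambda>a y. a * of_bool (P x y)) n ys = n * of_bool (\<forall>y\<in>set ys. P x y)" for n :: nat and x ys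
    by (induction ys arbitrary: n) auto
  from this[where n = 1] have
    eq: "of_bool (\<forall>y\<in>set (list_decode (l x)). P x y) =
      foldl (\<lambda>a y. a * of_bool (P x y)) (1::nat) (list_decode (l x))" for x
    by (simp only: mult_1)
  have [pr_intros]: "prp (\<lambda>z. P (pfst z) (psnd (psnd z)))"
    by (rule pr_comp2[OF assms(2)]) (intro pr_intros)+
  show ?thesis
    by (rule pr_cong[OF eq]) (intro pr_intros assms)
qed


section \<open>Simulation of Turing machines\<close>

lemma tm_halted_step: "tm_halted M c \<Longrightarrow> tm_step M c = c"
  by (cases c) simp

lemma tm_halted_funpow: "tm_halted M c \<Longrightarrow> (tm_step M ^^ k) c = c"
  by (induction k) (auto simp: tm_halted_step)

lemma tm_halted_mono:
  assumes "tm_halted M ((tm_step M ^^ j) c)" "j \<le> k"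
  shows "(tm_step M ^^ k) c = (tm_step M ^^ j) c"
proof -
  have "(tm_step M ^^ k) c = (tm_step M ^^ (k - j)) ((tm_step M ^^ j) c)"
    using assms(2) by (metis comp_apply funpow_add le_add_diff_inverse2)
  then show ?thesis
    using tm_halted_funpow[OF assms(1)] by simp
qed

lemma tm_returns_eventually_halted:
  "tm_returns M n v \<Longrightarrow> \<exists>j. \<forall>k\<ge>j. tm_halted M ((tm_step M ^^ k) (tm_initial n))"
  unfolding tm_returns_def using tm_halted_mono by metis

lemma tm_returns_output:
  assumes "tm_returns M n v" "tm_halted M ((tm_step M ^^ k) (tm_initial n))"
  shows "tm_output ((tm_step M ^^ k) (tm_initial n)) v"
proof -
  obtain j where "tm_halted M ((tm_step M ^^ j) (tm_initial n))"
    "tm_output ((tm_step M ^^ j) (tm_initial n)) v"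
    using assms(1) unfolding tm_returns_def by blast
  then show ?thesis
    using tm_halted_mono[of M j "tm_initial n" k] tm_halted_mono[of M k "tm_initial n" j] assms(2)
    by (metis nat_le_linear)
qed

lemma tm_output_unique: "tm_output c v \<Longrightarrow> tm_output c w \<Longrightarrow> v = w"
  by (cases c) (metis linorder_neqE_nat tm_output.simps)

text \<open>A half tape is a stream of symbols, coded by iterated pairing; as \<open>0\<close> codes the pair
  \<open>(0, 0)\<close>, it is also the code of the blank stream.\<close>

definition cell :: "nat \<Rightarrow> nat \<Rightarrow> nat" where
  "cell s i = pfst ((psnd ^^ i) s)"

lemma cell_0: "cell s 0 = pfst s"
  and cell_Suc: "cell s (Suc i) = cell (psnd s) i"
  and cell_prod_encode: "cell (prod_encode (a, s)) i = (case i of 0 \<Rightarrow> a | Suc j \<Rightarrow> cell s j)"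
  by (simp_all add: cell_def funpow_swap1 split: nat.split)

text \<open>An accumulator 0 means that no entry has matched yet, so the first match is kept, as
  with \<open>map_of\<close>; the shift by \<open>Suc\<close> separates a found action from
  failure.\<close>

definition lookup :: "nat \<Rightarrow> nat \<Rightarrow> nat \<Rightarrow> nat" where
  "lookup m q a =
     foldl (\<lambda>r i. if r = 0 \<and> pfst i = q \<and> pfst (psnd i) = a then Suc (psnd (psnd i)) else r) 0
       (list_decode m)"

definition action_code :: "nat \<times> nat \<times> direction \<Rightarrow> nat" where
  "action_code x = (case x of (q, b, D) \<Rightarrow> prod_encode (q, prod_encode (b, direction_code D)))"

lemma lookup_tm_code:
  "lookup (tm_code M) q a = (case map_of M (q, a) of None \<Rightarrow> 0 | Some x \<Rightarrow> Suc (action_code x))"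
proof -
  let ?h = "\<lambda>r i. if r = 0 \<and> pfst i = q \<and> pfst (psnd i) = a then Suc (psnd (psnd i)) else r"
  have found: "foldl ?h (Suc r) is = Suc r" for r "is"
    by (induction "is") auto
  have "foldl ?h 0 (map instruction_code M) =
      (case map_of M (q, a) of None \<Rightarrow> 0 | Some x \<Rightarrow> Suc (action_code x))"
  proof (induction M)
    case (Cons i M)
    obtain q1 a1 q2 b D where "i = ((q1, a1), (q2, b, D))"
      by (metis surj_pair)
    then show ?case
      using Cons found by (auto simp: action_code_def)
  qed simp
  then show ?thesis
    by (simp add: lookup_def tm_code_def)
qed

definition halted_code :: "nat \<Rightarrow> nat \<Rightarrow> bool" where
  "halted_code m c \<longleftrightarrow> lookup m (pfst c) (pfst (psnd (psnd c))) = 0"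

text \<open>A configuration is coded as \<open>(q, (l, r))\<close>: \<open>r\<close> is the half
  tape from the head cell to the right and \<open>l\<close> the cells to its left, nearest first. A
  move shifts one symbol between the two streams.\<close>

definition step_code :: "nat \<Rightarrow> nat \<Rightarrow> nat" where
  "step_code m c =
     (let r = lookup m (pfst c) (pfst (psnd (psnd c))) in
      if r = 0 then c else
      let l = pfst (psnd c); r' = prod_encode (pfst (psnd (r - 1)), psnd (psnd (psnd c)));
        D = psnd (psnd (r - 1)) in
      prod_encode (pfst (r - 1),
        if D = 0 then prod_encode (psnd l, prod_encode (pfst l, r'))
        else if D = 1 then prod_encode (l, r')
        else prod_encode (prod_encode (pfst r', l), psnd r')))"

definition init_code :: "nat \<Rightarrow> nat" where
  "init_code n = prod_encode (0, prod_encode (0, ((\<lambda>s. prod_encode (1, s)) ^^ n) 0))"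

definition run_code :: "nat \<Rightarrow> nat \<Rightarrow> nat \<Rightarrow> nat" where
  "run_code m n k = (step_code m ^^ k) (init_code n)"

fun represents :: "nat \<Rightarrow> tm_config \<Rightarrow> bool" where
  "represents c (q, T, p) \<longleftrightarrow> pfst c = q \<and>
     (\<forall>i. cell (pfst (psnd c)) i = T (p - 1 - int i)) \<and>
     (\<forall>i. cell (psnd (psnd c)) i = T (p + int i))"

lemma represents_init: "represents (init_code n) (tm_initial n)"
proof -
  have blank: "cell 0 i = 0" for i
    by (induction i) (auto simp: cell_0 cell_Suc)
  have "cell (((\<lambda>s. prod_encode (1, s)) ^^ n) 0) i = (if i < n then 1 else 0)" for i
  proof (induction n arbitrary: i)
    case (Suc n)
    then show ?case
      by (cases i) (auto simp: cell_prod_encode)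
  qed (simp add: blank)
  with blank show ?thesis
    by (simp add: init_code_def tm_initial_def)
qed

lemma represents_head: "represents c (q, T, p) \<Longrightarrow> pfst (psnd (psnd c)) = T p"
  by (metis add.right_neutral cell_0 of_nat_0 represents.simps)

lemma halted_code_iff: "represents c x \<Longrightarrow> halted_code (tm_code M) c \<longleftrightarrow> tm_halted M x"
proof (cases x)
  case (fields q T p)
  assume "represents c x"
  then show ?thesis
    unfolding fields halted_code_def lookup_tm_code using represents_head[of c q T p]
    by (auto split: option.split)
qed

lemma represents_step:
  assumes "represents c x"
  shows "represents (step_code (tm_code M) c) (tm_step M x)"
proof (cases x)
  case (fields q T p)
  note rep = assms[unfolded fields]
  let ?l = "pfst (psnd c)" and ?r = "psnd (psnd c)"
  have q: "pfst c = q" and l: "cell ?l i = T (p - 1 - int i)" and r: "cell ?r i = T (p + int i)" for i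
    using rep by auto
  have r': "cell (psnd ?r) i = T (p + 1 + int i)" for i
    using r[of "Suc i"] by (simp add: cell_Suc algebra_simps)
  have l': "cell (psnd ?l) i = T (p - 2 - int i)" for i
    using l[of "Suc i"] by (simp add: cell_Suc algebra_simps)
  have l0: "pfst ?l = T (p - 1)"
    using l[of 0] by (simp add: cell_0)
  show ?thesis
  proof (cases "map_of M (q, T p)")
    case None
    then show ?thesis
      using rep represents_head[OF rep] by (simp add: fields step_code_def lookup_tm_code)
  next
    case (Some y)
    obtain q' b D where y: "y = (q', b, D)"
      by (cases y)
    have lk: "lookup (tm_code M) q (T p) = Suc (prod_encode (q', prod_encode (b, direction_code D)))"
      by (simp add: lookup_tm_code Some y action_code_def)
    have step: "step_code (tm_code M) c =
      prod_encode (q',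
        if direction_code D = 0 then prod_encode (psnd ?l, prod_encode (pfst ?l, prod_encode (b, psnd ?r)))
        else if direction_code D = 1 then prod_encode (?l, prod_encode (b, psnd ?r))
        else prod_encode (prod_encode (b, ?l), psnd ?r))"
      unfolding step_code_def represents_head[OF rep] q lk by (simp add: Let_def)
    show ?thesis
      unfolding fields step using Some y q l r l' r' l0
      by (cases D) (auto simp: cell_prod_encode algebra_simps split: nat.split)
  qed
qed

lemma represents_run:
  "represents (run_code (tm_code M) n k) ((tm_step M ^^ k) (tm_initial n))"
  unfolding run_code_def by (induction k) (auto simp: represents_init intro: represents_step)

section \<open>Unary output read from a coded tape\<close>

definition count_step :: "nat \<Rightarrow> nat" where
  "count_step s = (if pfst (psnd s) = 1 then prod_encode (Suc (pfst s), psnd (psnd s)) else s)"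

definition count_ones :: "nat \<Rightarrow> nat \<Rightarrow> nat" where
  "count_ones c k = (count_step ^^ k) (prod_encode (0, psnd (psnd c)))"

text \<open>A scan of \<open>k\<close> steps may be too short. The last alternative tells the cases
  apart: unless all \<open>k\<close> cells were ones, the scan has stopped at a symbol other than 1,
  which then stands first in the remaining stream.\<close>

lemma count_ones_invariant:
  fixes c k
  defines "s \<equiv> count_ones c k"
  shows "psnd s = (psnd ^^ pfst s) (psnd (psnd c)) \<and>
    (\<forall>i<pfst s. cell (psnd (psnd c)) i = 1) \<and>
    (pfst s = k \<or> cell (psnd (psnd c)) (pfst s) \<noteq> 1)"
  unfolding s_def
proof (induction k)
  case (Suc k)
  have "count_ones c (Suc k) = count_step (count_ones c k)"
    by (simp add: count_ones_def)
  with Suc show ?case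
    by (auto simp: count_step_def cell_def less_Suc_eq)
qed (simp add: count_ones_def)

lemma count_ones_output:
  assumes "represents c x" "pfst (psnd (count_ones c k)) \<noteq> 1"
  shows "tm_output x (pfst (count_ones c k))"
proof (cases x)
  case (fields q T p)
  then show ?thesis
    using assms count_ones_invariant[of c k] by (auto simp: cell_def)
qed

lemma count_ones_complete:
  assumes "represents c x" "tm_output x v" "v \<le> k"
  shows "pfst (psnd (count_ones c k)) \<noteq> 1"
proof (cases x)
  case (fields q T p)
  let ?n = "pfst (count_ones c k)"
  have "cell (psnd (psnd c)) v \<noteq> 1"
    using assms fields by auto
  with count_ones_invariant[of c k] have "cell (psnd (psnd c)) ?n \<noteq> 1"
    using assms(3) by (metis le_neq_implies_less)
  then show ?thesis
    using count_ones_invariant[of c k] by (simp add: cell_def)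
qed

lemma pr_lookup [pr_intros]:
  assumes "pr f" "pr g" "pr h"
  shows "pr (\<lambda>x. lookup (f x) (g x) (h x))"
proof -
  have "pr (\<lambda>z. lookup (pfst z) (pfst (psnd z)) (psnd (psnd z)))"
    unfolding lookup_def by (intro pr_intros)
  from pr_comp3[OF this assms] show ?thesis .
qed

lemma prp_halted_code [pr_intros]: "pr f \<Longrightarrow> pr g \<Longrightarrow> prp (\<lambda>x. halted_code (f x) (g x))"
  unfolding halted_code_def by (intro pr_intros)

lemma pr_step_code: "pr (\<lambda>z. step_code (pfst z) (psnd z))"
  unfolding step_code_def by (intro pr_intros)

lemma pr_run_code [pr_intros]:
  assumes "pr f" "pr g" "pr h"
  shows "pr (\<lambda>x. run_code (f x) (g x) (h x))"
proof -
  have "pr (\<lambda>z. run_code (pfst z) (pfst (psnd z)) (psnd (psnd z)))"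
    unfolding run_code_def init_code_def by (intro pr_intros pr_comp2[OF pr_step_code])
  from pr_comp3[OF this assms] show ?thesis .
qed

lemma pr_count_ones [pr_intros]:
  "pr f \<Longrightarrow> pr g \<Longrightarrow> pr (\<lambda>x. count_ones (f x) (g x))"
  unfolding count_ones_def count_step_def by (intro pr_intros)


section \<open>Enumeration of patterns\<close>

text \<open>Under \<open>int_encode\<close> the nonnegative integers receive the even codes, so a
  coordinate below \<open>n\<close> is an even code below \<open>2 * n\<close>; evenness is the
  absence of bit 0.\<close>

definition cube_code :: "nat \<Rightarrow> nat \<Rightarrow> nat \<Rightarrow> bool" where
  "cube_code d n k \<longleftrightarrow>
     length (list_decode k) = d \<and> (\<forall>e\<in>set (list_decode k). 0 \<notin> set_decode e \<and> e < 2 * n)"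

definition point_code :: "int list \<Rightarrow> nat" where
  "point_code v = list_encode (map int_encode v)"

definition point_decode :: "nat \<Rightarrow> int list" where
  "point_decode k = map int_decode (list_decode k)"

lemma point_code_inverse [simp]: "point_decode (point_code v) = v"
  and point_decode_inverse [simp]: "point_code (point_decode k) = k"
  by (simp_all add: point_code_def point_decode_def comp_def)

lemma cube_code_iff: "cube_code d n k \<longleftrightarrow> point_decode k \<in> cube d n"
proof -
  have "0 \<notin> set_decode e \<and> e < 2 * n \<longleftrightarrow> int_decode e \<in> {0..int n - 1}" for e
    by (auto simp: int_decode_def sum_decode_def)
  then show ?thesis
    by (auto simp: cube_code_def cube_def lattice_def point_decode_def)
qed

lemma cube_eq_lists: "cube d n = {v. set v \<subseteq> {0..int n - 1} \<and> length v = d}"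
  by (auto simp: cube_def lattice_def)

lemma finite_cube: "finite (cube d n)"
  and card_cube: "card (cube d n) = n ^ d"
  unfolding cube_eq_lists by (simp_all add: finite_lists_length_eq card_lists_length_eq)

text \<open>Each pattern has one listing in which the codes of the positions increase; only these
  listings are enumerated.\<close>

definition increasing_code :: "nat \<Rightarrow> bool" where
  "increasing_code c \<longleftrightarrow>
     foldl (\<lambda>m y. if m \<noteq> 0 \<and> m \<le> Suc (pfst y) then Suc (Suc (pfst y)) else 0) 1 (list_decode c) \<noteq> 0"

definition valid_code :: "nat \<Rightarrow> nat \<Rightarrow> nat \<Rightarrow> nat \<Rightarrow> bool" where
  "valid_code d a n c \<longleftrightarrow>
     length (list_decode c) = n ^ d \<and>
     (\<forall>y\<in>set (list_decode c). cube_code d n (pfst y) \<and> psnd y \<in> set_decode a) \<and>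
     increasing_code c"

lemma increasing_code_iff: "increasing_code c \<longleftrightarrow> sorted_wrt (<) (map pfst (list_decode c))"
proof -
  let ?h = "\<lambda>m y. if m \<noteq> 0 \<and> m \<le> Suc (pfst y) then Suc (Suc (pfst y)) else 0"
  have fail: "foldl ?h 0 ys = 0" for ys
    by (induction ys) auto
  have "foldl ?h (Suc m) ys \<noteq> 0 \<longleftrightarrow> (\<forall>y\<in>set ys. m \<le> pfst y) \<and> sorted_wrt (<) (map pfst ys)" for m ys
  proof (induction ys arbitrary: m)
    case (Cons y ys)
    show ?case
    proof (cases "m \<le> pfst y")
      case True
      then have trans: "m \<le> pfst z" if "pfst y < pfst z" for z
        using that by linarith
      have "foldl ?h (Suc m) (y # ys) \<noteq> 0 \<longleftrightarrow> foldl ?h (Suc (Suc (pfst y))) ys \<noteq> 0"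
        using True by simp
      also note Cons.IH
      finally show ?thesis
        using True by (auto simp: Suc_le_eq intro!: trans)
    next
      case False
      then have "foldl ?h (Suc m) (y # ys) = 0"
        using fail by simp
      then show ?thesis
        using False by simp
    qed
  qed simp
  from this[of 0 "list_decode c"] show ?thesis
    by (simp add: increasing_code_def)
qed

definition cube_keys :: "nat \<Rightarrow> nat \<Rightarrow> nat list" where
  "cube_keys d n = sorted_list_of_set (point_code ` cube d n)"

lemma set_cube_keys: "set (cube_keys d n) = point_code ` cube d n"
  and distinct_cube_keys: "distinct (cube_keys d n)"
  and sorted_cube_keys: "sorted_wrt (<) (cube_keys d n)"
  by (simp_all add: cube_keys_def finite_cube)

lemma length_cube_keys: "length (cube_keys d n) = n ^ d"
proof -
  have "inj_on point_code (cube d n)"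
    by (rule inj_on_inverseI[where g = point_decode]) simp
  then show ?thesis
    using distinct_card[OF distinct_cube_keys[of d n]]
    by (simp add: set_cube_keys card_image card_cube)
qed

lemma mem_cube_keys: "k \<in> set (cube_keys d n) \<longleftrightarrow> cube_code d n k"
proof
  assume "cube_code d n k"
  then have "point_code (point_decode k) \<in> point_code ` cube d n"
    unfolding cube_code_iff by (rule imageI)
  then show "k \<in> set (cube_keys d n)"
    by (simp add: set_cube_keys)
qed (auto simp: set_cube_keys cube_code_iff)

text \<open>A strictly increasing list of \<open>n ^ d\<close> keys taken from the cube has no
  choice: it is the sorted enumeration of the whole cube.\<close>

lemma valid_code_iff:
  assumes "finite A"
  shows "valid_code d (set_encode A) n c \<longleftrightarrow>
    map pfst (list_decode c) = cube_keys d n \<and> psnd ` set (list_decode c) \<subseteq> A"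
proof
  let ?ks = "map pfst (list_decode c)"
  assume v: "valid_code d (set_encode A) n c"
  then have sub: "set ?ks \<subseteq> set (cube_keys d n)" and sorted: "sorted_wrt (<) ?ks"
    and len: "length ?ks = length (cube_keys d n)"
    by (auto simp: valid_code_def increasing_code_iff mem_cube_keys length_cube_keys)
  from sorted have "distinct ?ks"
    by (simp add: strict_sorted_iff)
  then have "card (set ?ks) = card (set (cube_keys d n))"
    using len distinct_card distinct_cube_keys by metis
  then have "set ?ks = set (cube_keys d n)"
    using sub card_subset_eq by blast
  then have "?ks = cube_keys d n"
    using strict_sorted_equal[OF sorted sorted_cube_keys] by simp
  then show "?ks = cube_keys d n \<and> psnd ` set (list_decode c) \<subseteq> A"
    using v assms by (auto simp: valid_code_def)
next
  assume *: "map pfst (list_decode c) = cube_keys d n \<and> psnd ` set (list_decode c) \<subseteq> A"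
  then have "length (list_decode c) = n ^ d"
    using length_cube_keys by (metis length_map)
  moreover have "cube_code d n (pfst y)" if "y \<in> set (list_decode c)" for y
    using * that by (metis image_eqI list.set_map mem_cube_keys)
  ultimately show "valid_code d (set_encode A) n c"
    using * assms sorted_cube_keys[of d n] by (auto simp: valid_code_def increasing_code_iff)
qed

lemma map_pair_eqI: "map pfst xs = map pfst ys \<Longrightarrow> map psnd xs = map psnd ys \<Longrightarrow> xs = ys"
proof (induction xs arbitrary: ys)
  case (Cons x xs)
  then show ?case
    by (cases ys) (auto, metis prod_encode_pfst_psnd)
qed simp

text \<open>The keys being fixed, a valid code amounts to its word of symbols. This yields the
  number of valid codes in advance, by which the search recognises that it has found them
  all.\<close>

lemma bij_betw_valid_code:
  assumes "finite A"
  shows "bij_betw (\<lambda>c. map psnd (list_decode c)) {c. valid_code d (set_encode A) n c}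
    {w. set w \<subseteq> A \<and> length w = n ^ d}"
proof (rule bij_betwI')
  fix b c
  assume "b \<in> {c. valid_code d (set_encode A) n c}" "c \<in> {c. valid_code d (set_encode A) n c}"
  then have "map pfst (list_decode b) = map pfst (list_decode c)"
    by (simp add: valid_code_iff[OF assms])
  then show "(map psnd (list_decode b) = map psnd (list_decode c)) = (b = c)"
    using map_pair_eqI list_decode_eq by blast
next
  fix c assume "c \<in> {c. valid_code d (set_encode A) n c}"
  then show "map psnd (list_decode c) \<in> {w. set w \<subseteq> A \<and> length w = n ^ d}"
    using assms by (auto simp: valid_code_def)
next
  fix w assume w: "w \<in> {w. set w \<subseteq> A \<and> length w = n ^ d}"
  define c where "c = list_encode (map prod_encode (zip (cube_keys d n) w))"
  have len: "length (cube_keys d n) = length w"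
    using w length_cube_keys by simp
  have "map pfst (list_decode c) = cube_keys d n" "map psnd (list_decode c) = w"
    using len by (auto simp: c_def comp_def pfst_def psnd_def)
  moreover from this have "psnd ` set (list_decode c) \<subseteq> A"
    using w by (metis (mono_tags, lifting) list.set_map mem_Collect_eq)
  ultimately show "\<exists>c\<in>{c. valid_code d (set_encode A) n c}. w = map psnd (list_decode c)"
    by (intro bexI[of _ c]) (auto simp: valid_code_iff[OF assms])
qed

lemma finite_valid_code: "finite A \<Longrightarrow> finite {c. valid_code d (set_encode A) n c}"
  and card_valid_code: "finite A \<Longrightarrow> card {c. valid_code d (set_encode A) n c} = card A ^ (n ^ d)"
  using bij_betw_finite[OF bij_betw_valid_code] bij_betw_same_card[OF bij_betw_valid_code]
  by (simp_all add: finite_lists_length_eq card_lists_length_eq)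

section \<open>From codes to patterns\<close>

definition listing :: "nat \<Rightarrow> (int list \<times> nat) list" where
  "listing c = map (\<lambda>y. (point_decode (pfst y), psnd y)) (list_decode c)"

lemma pattern_code_listing: "pattern_code (listing c) = c"
proof -
  have "(case (point_decode (pfst y), psnd y) of
      (v, a) \<Rightarrow> prod_encode (list_encode (map int_encode v), a)) = y" for y
    using point_decode_inverse[of "pfst y"] by (simp add: point_code_def)
  then show ?thesis
    by (simp add: pattern_code_def listing_def comp_def)
qed

lemma listing_pattern_code: "listing (pattern_code ps) = ps"
proof -
  have "map ((\<lambda>y. (point_decode (pfst y), psnd y)) \<circ>
      (\<lambda>(v, a). prod_encode (list_encode (map int_encode v), a))) ps = ps"
    using point_code_inverse by (intro map_idI) (auto simp: point_code_def)
  then show ?thesis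
    by (simp only: pattern_code_def listing_def list_encode_inverse map_map)
qed

lemma valid_code_listing:
  assumes "finite A" "valid_code d (set_encode A) n c"
  shows "map fst (listing c) = map point_decode (cube_keys d n)"
    and "snd ` set (listing c) \<subseteq> A"
proof -
  have "map fst (listing c) = map point_decode (map pfst (list_decode c))"
    by (simp add: listing_def)
  also have "map pfst (list_decode c) = cube_keys d n"
    using assms by (simp add: valid_code_iff)
  finally show "map fst (listing c) = map point_decode (cube_keys d n)" .
  show "snd ` set (listing c) \<subseteq> A"
    using assms by (auto simp: listing_def valid_code_iff)
qed

lemma distinct_cube_points: "distinct (map point_decode (cube_keys d n))"
  and set_cube_points: "set (map point_decode (cube_keys d n)) = cube d n"
proof -
  show "distinct (map point_decode (cube_keys d n))"
    unfolding distinct_map using distinct_cube_keys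
    by (metis inj_on_inverseI point_decode_inverse)
  show "set (map point_decode (cube_keys d n)) = cube d n"
    by (force simp: set_cube_keys image_iff)
qed

lemma valid_code_pattern_listings:
  assumes "finite A" "valid_code d (set_encode A) n c"
  shows "listing c \<in> pattern_listings d A" "dom (map_of (listing c)) = cube d n"
proof -
  have "fst ` set (listing c) = cube d n"
    using valid_code_listing(1)[OF assms] set_cube_points by (metis list.set_map)
  moreover have "cube d n \<subseteq> lattice d"
    by (auto simp: cube_def)
  ultimately show "listing c \<in> pattern_listings d A" "dom (map_of (listing c)) = cube d n"
    using valid_code_listing[OF assms] distinct_cube_points
    by (auto simp: pattern_listings_def dom_map_of_conv_image_fst)
qed

lemma card_language_on_cube:
  assumes "finite A" "\<Sigma> \<subseteq> lattice d \<rightarrow>\<^sub>E A"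
  shows "card {c. valid_code d (set_encode A) n c \<and> map_of (listing c) \<in> language d \<Sigma>} =
    card (language_on \<Sigma> (cube d n))"
proof -
  let ?V = "{c. valid_code d (set_encode A) n c \<and> map_of (listing c) \<in> language d \<Sigma>}"
  let ?g = "\<lambda>c. map_of (listing c)"
  let ?vs = "map point_decode (cube_keys d n)"
  have sub: "cube d n \<subseteq> lattice d"
    by (auto simp: cube_def)
  have dom: "dom (pattern_at x U) = U" for x :: "int list \<Rightarrow> nat" and U
    by (auto simp: pattern_at_def)
  have "inj_on ?g ?V"
  proof
    fix b c assume bc: "b \<in> ?V" "c \<in> ?V" "?g b = ?g c"
    have fst: "map fst (listing b) = ?vs" "map fst (listing c) = ?vs"
      using bc valid_code_listing[OF assms(1)] by auto
    have "map snd (listing b) = map snd (listing c)"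
    proof (rule map_of_zip_inject[OF _ _ distinct_cube_points])
      show "map_of (zip ?vs (map snd (listing b))) = map_of (zip ?vs (map snd (listing c)))"
        using bc(3) fst zip_map_fst_snd by metis
    qed (metis fst length_map)+
    then have "listing b = listing c"
      using fst zip_map_fst_snd by metis
    then show "b = c"
      using pattern_code_listing by metis
  qed
  moreover have "?g ` ?V = language_on \<Sigma> (cube d n)"
  proof
    show "?g ` ?V \<subseteq> language_on \<Sigma> (cube d n)"
    proof
      fix p assume "p \<in> ?g ` ?V"
      then obtain c where c: "valid_code d (set_encode A) n c" "p = ?g c" "p \<in> language d \<Sigma>"
        by auto
      \<comment> \<open>The language allows any finite support \<open>U\<close>; the domain of the
        pattern forces \<open>U\<close> to be the cube.\<close>
      then obtain U x where "x \<in> \<Sigma>" "p = pattern_at x U"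
        by (auto simp: language_def language_on_def)
      then show "p \<in> language_on \<Sigma> (cube d n)"
        using valid_code_pattern_listings(2)[OF assms(1) c(1)] c(2) dom[of x U]
        by (auto simp: language_on_def)
    qed
    show "language_on \<Sigma> (cube d n) \<subseteq> ?g ` ?V"
    proof
      fix p assume p: "p \<in> language_on \<Sigma> (cube d n)"
      then obtain x where x: "x \<in> \<Sigma>" "p = pattern_at x (cube d n)"
        by (auto simp: language_on_def)
      define ps where "ps = map (\<lambda>v. (v, x v)) ?vs"
      define c where "c = pattern_code ps"
      have ps: "listing c = ps"
        by (simp add: c_def listing_pattern_code)
      have "map_of ps = p"
        unfolding ps_def map_of_map_restrict set_cube_points x(2) pattern_at_def ..
      moreover have "x v \<in> A" if "v \<in> cube d n" for v
        using x(1) assms(2) sub that by blast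
      then have "x (point_decode k) \<in> A" if "k \<in> set (cube_keys d n)" for k
        using that set_cube_points[of d n] by auto
      then have "valid_code d (set_encode A) n c"
        by (auto simp: valid_code_iff[OF assms(1)] c_def pattern_code_def ps_def comp_def
            point_code_def[symmetric])
      moreover have "p \<in> language d \<Sigma>"
        using p finite_cube sub by (auto simp: language_def)
      ultimately show "p \<in> ?g ` ?V"
        using ps by auto
    qed
  qed
  ultimately show ?thesis
    using card_image[of ?g ?V] by simp
qed

lemma prp_cube_code [pr_intros]:
  assumes "pr f" "pr g"
  shows "prp (\<lambda>x. cube_code d (f x) (g x))"
proof -
  have "prp (\<lambda>z. cube_code d (pfst z) (psnd z))"
    unfolding cube_code_def by (intro pr_intros)
  from pr_comp2[OF this assms] show ?thesis .
qed

lemma prp_valid_code [pr_intros]: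
  assumes "pr f" "pr g" "pr h"
  shows "prp (\<lambda>x. valid_code d (f x) (g x) (h x))"
proof -
  have "prp (\<lambda>z. valid_code d (pfst z) (pfst (psnd z)) (psnd (psnd z)))"
    unfolding valid_code_def increasing_code_def by (intro pr_intros)
  from pr_comp3[OF this assms] show ?thesis .
qed


section \<open>Entropy under block gluing\<close>

text \<open>A form of Fekete's lemma for densities in dimension \<open>d\<close>. Monotonicity and
  the inequality on multiples suffice, since every \<open>m\<close> lies below a multiple of
  \<open>a\<close> that exceeds it by at most \<open>a\<close>.\<close>

lemma power_subadditive_limit:
  fixes H :: "nat \<Rightarrow> real"
  assumes mono: "mono H" and nonneg: "\<And>n. 0 \<le> H n"
    and sub: "\<And>k a. H (k * a) \<le> real k ^ d * H a"
  obtains h where "(\<lambda>n. H n / real n ^ d) \<longlonglongrightarrow> h" "\<And>n. n \<ge> 1 \<Longrightarrow> h \<le> H n / real n ^ d"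
proof
  define h where "h = (INF n\<in>{1..}. H n / real n ^ d)"
  have bdd: "bdd_below ((\<lambda>n. H n / real n ^ d) ` {1..})"
    by (rule bdd_belowI2[of _ 0]) (simp add: nonneg)
  show le: "h \<le> H n / real n ^ d" if "n \<ge> 1" for n
    unfolding h_def by (rule cINF_lower[OF bdd]) (use that in simp)
  show "(\<lambda>n. H n / real n ^ d) \<longlonglongrightarrow> h"
  proof (rule order_tendstoI)
    fix c assume "c < h"
    then show "\<forall>\<^sub>F n in sequentially. c < H n / real n ^ d"
      by (intro eventually_sequentiallyI[of 1]) (use le less_le_trans in blast)
  next
    fix c assume "h < c"
    then obtain a where a: "a \<ge> 1" "H a / real a ^ d < c"
      unfolding h_def by (subst (asm) cINF_less_iff[OF _ bdd]) auto
    \<comment> \<open>The bound for \<open>H m / m ^ d\<close> replaces \<open>m / a\<close> by at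
      most \<open>m / a + 1\<close>; after division by \<open>m\<close> this rounding vanishes in
      the limit.\<close>
    have "(\<lambda>m. (1 / real a + 1 / real m) ^ d * H a) \<longlonglongrightarrow> (1 / real a + 0) ^ d * H a"
      by (intro tendsto_intros lim_1_over_n)
    moreover have "(1 / real a + 0) ^ d * H a < c"
      using a by (simp add: power_one_over divide_simps)
    ultimately have "\<forall>\<^sub>F m in sequentially. (1 / real a + 1 / real m) ^ d * H a < c"
      by (rule order_tendstoD)
    moreover have "\<forall>\<^sub>F m in sequentially. H m / real m ^ d \<le> (1 / real a + 1 / real m) ^ d * H a"
    proof (rule eventually_sequentiallyI[of 1])
      fix m :: nat assume m: "m \<ge> 1"
      let ?k = "m div a + 1"
      have "m \<le> ?k * a"
        using dividend_less_div_times[of a m] a by (simp add: algebra_simps)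
      then have "H m \<le> H (?k * a)"
        using mono by (rule monoD[rotated])
      also have "\<dots> \<le> real ?k ^ d * H a"
        by (rule sub)
      also have "real ?k \<le> real m / real a + 1"
        using of_nat_div_le_of_nat[of m a] by simp
      then have "real ?k ^ d * H a \<le> (real m / real a + 1) ^ d * H a"
        by (intro mult_right_mono power_mono nonneg) auto
      finally have "H m / real m ^ d \<le> (real m / real a + 1) ^ d * H a / real m ^ d"
        by (rule divide_right_mono) simp
      also have "\<dots> = ((real m / real a + 1) / real m) ^ d * H a"
        by (simp add: power_divide)
      also have "(real m / real a + 1) / real m = 1 / real a + 1 / real m"
        using m a by (simp add: field_simps)
      finally show "H m / real m ^ d \<le> (1 / real a + 1 / real m) ^ d * H a" .
    qed
    ultimately show "\<forall>\<^sub>F n in sequentially. H n / real n ^ d < c"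
      by eventually_elim simp
  qed
qed

text \<open>Along \<open>\<nu> (j + 1) = 2 \<nu> j + f (4 \<nu> j)\<close> the density \<open>H n / n ^ d\<close> loses at most the factor
  \<open>(2 \<nu> j / \<nu> (j + 1)) ^ d\<close> per step, and the total loss is controlled by the tail of the series,
  because the intervals \<open>[4 \<nu> j, 8 \<nu> j)\<close> are disjoint.\<close>

lemma doubling_lower_bound:
  fixes H :: "nat \<Rightarrow> real" and f :: "nat \<Rightarrow> nat"
  assumes "mono f" and nonneg: "\<And>n. 0 \<le> H n"
    and doubling: "\<And>n. n \<ge> 1 \<Longrightarrow> f (4 * n) \<le> n \<Longrightarrow> 2 ^ d * H n \<le> H (2 * n + f (4 * n))"
    and lim: "(\<lambda>n. H n / real n ^ d) \<longlonglongrightarrow> h"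
    and summable: "summable (\<lambda>n. real (f n) / (real n)\<^sup>2)"
    and tail: "(\<Sum>k. real (f (K + k)) / (real (K + k))\<^sup>2) \<le> \<epsilon>" "\<epsilon> \<le> 1 / 16"
    and n: "n \<ge> 1" "K \<le> 4 * n"
  shows "H n / real n ^ d * (1 - 8 * real d * \<epsilon>) \<le> h"
proof -
  define a where "a n = real (f n) / (real n)\<^sup>2" for n
  have a_nonneg: "0 \<le> a n" for n
    by (simp add: a_def)
  have sum_tail: "sum a {p..<q} \<le> \<epsilon>" if "K \<le> p" for p q
  proof -
    have "sum a {p..<q} \<le> sum a {K..<K + q}"
      by (rule sum_mono2) (use that a_nonneg in auto)
    also have "\<dots> = (\<Sum>k<q. a (K + k))"
      using sum.shift_bounds_nat_ivl[of a 0 K q] by (simp add: add.commute lessThan_atLeast0)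
    also have "\<dots> \<le> (\<Sum>k. a (K + k))"
      using summable_ignore_initial_segment[OF summable, of K] a_nonneg
      by (intro sum_le_suminf) (auto simp: a_def add.commute)
    also have "\<dots> \<le> \<epsilon>"
      using tail(1) by (simp add: a_def)
    finally show ?thesis .
  qed
  \<comment> \<open>By monotonicity each of the \<open>p\<close> terms from \<open>p\<close> to
    \<open>2 * p - 1\<close> is at least \<open>f p / (2 * p)^2\<close>; this is how the tail
    controls single values of \<open>f\<close>.\<close>
  have block: "real (f p) / (4 * real p) \<le> sum a {p..<2 * p}" if "p \<ge> 1" for p
  proof -
    have "real (f p) / (2 * real p)\<^sup>2 \<le> a k" if "k \<in> {p..<2 * p}" for k
      unfolding a_def using that \<open>p \<ge> 1\<close> monoD[OF \<open>mono f\<close>, of p k]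
      by (intro frac_le power_mono) auto
    then have "real (card {p..<2 * p}) * (real (f p) / (2 * real p)\<^sup>2) \<le> sum a {p..<2 * p}"
      by (intro sum_bounded_below) auto
    then show ?thesis
      using that by (simp add: power2_eq_square)
  qed
  \<comment> \<open>At \<open>4 * p\<close> the block bound reads
    \<open>f (4 * p) / (16 * p) \<le> \<epsilon>\<close>, which explains the condition
    \<open>\<epsilon> \<le> 1 / 16\<close>.\<close>
  have small: "f (4 * p) \<le> p" if "p \<ge> n" for p
  proof -
    have "real (f (4 * p)) / (4 * real (4 * p)) \<le> sum a {4 * p..<2 * (4 * p)}"
      by (rule block) (use that n in simp)
    also have "\<dots> \<le> \<epsilon>"
      by (rule sum_tail) (use that n in simp)
    finally have "real (f (4 * p)) / (4 * real (4 * p)) \<le> 1 / 16"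
      using tail(2) by simp
    then have "real (f (4 * p)) \<le> real p"
      using that n by (simp add: field_simps)
    then show ?thesis
      by simp
  qed
  define \<nu> where "\<nu> = rec_nat n (\<lambda>_ p. 2 * p + f (4 * p))"
  have \<nu>_0: "\<nu> 0 = n" and \<nu>_Suc: "\<nu> (Suc j) = 2 * \<nu> j + f (4 * \<nu> j)" for j
    by (simp_all add: \<nu>_def)
  have ge: "\<nu> j \<ge> n" for j
    by (induction j) (auto simp: \<nu>_0 \<nu>_Suc)
  have pos: "\<nu> j \<ge> 1" for j
    using ge[of j] n by simp
  have "strict_mono \<nu>"
    unfolding strict_mono_Suc_iff
  proof
    show "\<nu> j < \<nu> (Suc j)" for j
      using pos[of j] by (simp add: \<nu>_Suc)
  qed
  \<comment> \<open>The relative excess over doubling: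
    \<open>\<nu> (j + 1) = 2 * \<nu> j * (1 + b j)\<close>. It is 8 times the left side of the block
    bound at \<open>4 * \<nu> j\<close>.\<close>
  define b where "b j = real (f (4 * \<nu> j)) / (2 * real (\<nu> j))" for j
  have b_nonneg: "0 \<le> b j" for j
    by (simp add: b_def)
  have "(\<Sum>j<J. b j) \<le> 8 * sum a {4 * \<nu> 0..<4 * \<nu> J}" for J
  proof (induction J)
    case (Suc J)
    have "\<nu> 0 \<le> \<nu> J" "\<nu> J \<le> \<nu> (Suc J)"
      using ge by (auto simp: \<nu>_0 \<nu>_Suc)
    then have "sum a {4 * \<nu> 0..<4 * \<nu> (Suc J)} =
        sum a {4 * \<nu> 0..<4 * \<nu> J} + sum a {4 * \<nu> J..<4 * \<nu> (Suc J)}"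
      by (subst sum.atLeastLessThan_concat) auto
    moreover have "sum a {4 * \<nu> J..<2 * (4 * \<nu> J)} \<le> sum a {4 * \<nu> J..<4 * \<nu> (Suc J)}"
      by (rule sum_mono2) (auto simp: a_nonneg \<nu>_Suc)
    moreover have "b J \<le> 8 * sum a {4 * \<nu> J..<2 * (4 * \<nu> J)}"
      using block[of "4 * \<nu> J"] pos[of J] by (simp add: b_def)
    ultimately show ?case
      using Suc by simp
  qed simp
  moreover have "sum a {4 * \<nu> 0..<4 * \<nu> J} \<le> \<epsilon>" for J
    by (rule sum_tail) (use n \<nu>_0 in simp)
  ultimately have sum_b: "(\<Sum>j<J. b j) \<le> 8 * \<epsilon>" for J
    by (meson mult_left_mono order_trans zero_le_numeral)
  \<comment> \<open>Each step costs a factor \<open>(1 / (1 + b j)) ^ d\<close>, at least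
    \<open>(1 - b j) ^ d\<close>. The product of the factors \<open>1 - b j\<close> is bounded below
    by one minus their sum, which avoids infinite products.\<close>
  have density: "H n / real n ^ d * (1 - (\<Sum>j<J. b j)) ^ d \<le> H (\<nu> J) / real (\<nu> J) ^ d" for J
  proof (induction J)
    case (Suc J)
    let ?S = "\<Sum>j<J. b j"
    have S: "0 \<le> ?S" "?S + b J \<le> 1"
      using sum_b[of "Suc J"] tail(2) b_nonneg by (auto intro: sum_nonneg)
    have p: "real (\<nu> J) > 0"
      using pos[of J] by simp
    have \<nu>: "real (\<nu> (Suc J)) = 2 * real (\<nu> J) * (1 + b J)"
      using p by (simp add: \<nu>_Suc b_def field_simps)
    have "(1 - b J) * (1 + b J) \<le> 1"
      by (simp add: algebra_simps)
    then have ratio: "1 - b J \<le> 1 / (1 + b J)"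
      using b_nonneg[of J] by (simp add: pos_le_divide_eq)
    have "H n / real n ^ d * (1 - (\<Sum>j<Suc J. b j)) ^ d \<le> H n / real n ^ d * ((1 - ?S) * (1 - b J)) ^ d"
      using S b_nonneg[of J] nonneg
      by (intro mult_left_mono power_mono) (auto simp: algebra_simps)
    also have "\<dots> = H n / real n ^ d * (1 - ?S) ^ d * (1 - b J) ^ d"
      by (simp add: power_mult_distrib)
    also have "\<dots> \<le> H (\<nu> J) / real (\<nu> J) ^ d * (1 / (1 + b J)) ^ d"
      using S b_nonneg[of J] nonneg ratio by (intro mult_mono Suc.IH power_mono) auto
    also have "\<dots> = 2 ^ d * H (\<nu> J) / real (\<nu> (Suc J)) ^ d"
      unfolding \<nu> power_mult_distrib power_divide using p b_nonneg[of J] by simp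
    also have "\<dots> \<le> H (\<nu> (Suc J)) / real (\<nu> (Suc J)) ^ d"
      using doubling[OF pos small[OF ge], of J] by (intro divide_right_mono) (auto simp: \<nu>_Suc)
    finally show ?case .
  qed (simp add: \<nu>_0)
  have "H n / real n ^ d * (1 - 8 * real d * \<epsilon>) \<le> H (\<nu> J) / real (\<nu> J) ^ d" for J
  proof -
    have "1 - 8 * real d * \<epsilon> \<le> (1 - 8 * \<epsilon>) ^ d"
      using Bernoulli_inequality[of "- 8 * \<epsilon>" d] tail(2) by (simp add: mult_ac)
    also have "\<dots> \<le> (1 - (\<Sum>j<J. b j)) ^ d"
      using sum_b[of J] tail(2) by (intro power_mono) auto
    finally have "H n / real n ^ d * (1 - 8 * real d * \<epsilon>) \<le> H n / real n ^ d * (1 - (\<Sum>j<J. b j)) ^ d"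
      using nonneg by (intro mult_left_mono) auto
    then show ?thesis
      using density[of J] by simp
  qed
  moreover have "(\<lambda>J. H (\<nu> J) / real (\<nu> J) ^ d) \<longlonglongrightarrow> h"
    using LIMSEQ_subseq_LIMSEQ[OF lim \<open>strict_mono \<nu>\<close>] by (simp add: comp_def)
  ultimately show ?thesis
    by (intro LIMSEQ_le_const) auto
qed

text \<open>Boxes with independent side lengths, the intermediate shapes between two cubes when one
  coordinate is treated at a time.\<close>

definition brick :: "nat \<Rightarrow> (nat \<Rightarrow> nat) \<Rightarrow> int list set" where
  "brick d l = {v \<in> lattice d. \<forall>i<d. 0 \<le> v ! i \<and> v ! i < int (l i)}"

lemma brick_cong: "(\<And>i. i < d \<Longrightarrow> l i = m i) \<Longrightarrow> brick d l = brick d m"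
  by (auto simp: brick_def)

lemma cube_eq_brick: "cube d n = brick d (\<lambda>_. n)"
proof -
  have "set v \<subseteq> {0..int n - 1} \<longleftrightarrow> (\<forall>i<length v. 0 \<le> v ! i \<and> v ! i < int n)" for v
    by (auto simp: set_conv_nth subset_iff)
  then show ?thesis
    by (auto simp: cube_def brick_def lattice_def)
qed

lemma finite_brick: "finite (brick d l)"
proof -
  have "brick d l \<subseteq> {v. set v \<subseteq> {0..<int (\<Sum>i<d. l i)} \<and> length v = d}"
  proof
    fix v assume v: "v \<in> brick d l"
    have "v ! i \<in> {0..<int (\<Sum>i<d. l i)}" if "i < d" for i
    proof -
      have "int (l i) \<le> int (\<Sum>i<d. l i)"
        unfolding of_nat_le_iff using that by (intro member_le_sum) auto
      moreover have "0 \<le> v ! i" "v ! i < int (l i)"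
        using v that by (auto simp: brick_def)
      ultimately show ?thesis
        by (simp del: of_nat_sum)
    qed
    then show "v \<in> {v. set v \<subseteq> {0..<int (\<Sum>i<d. l i)} \<and> length v = d}"
      using v by (auto simp: brick_def lattice_def set_conv_nth)
  qed
  then show ?thesis
    using finite_lists_length_eq finite_atLeastLessThan_int finite_subset by blast
qed

definition axis :: "nat \<Rightarrow> nat \<Rightarrow> int \<Rightarrow> int list" where
  "axis d i a = (replicate d 0)[i := a]"

lemma axis_lattice: "axis d i a \<in> lattice d"
  by (simp add: axis_def lattice_def)

lemma vadd_axis: "v \<in> lattice d \<Longrightarrow> i < d \<Longrightarrow> vadd (axis d i a) v = v[i := v ! i + a]"
  by (intro nth_equalityI) (auto simp: axis_def vadd_def lattice_def nth_list_update)

lemma mem_translate_axis: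
  assumes "i < d" "U \<subseteq> lattice d" "v \<in> lattice d" "v[i := v ! i - a] \<in> U"
  shows "v \<in> translate (axis d i a) U"
proof -
  have "vadd (axis d i a) (v[i := v ! i - a]) = v"
    using assms by (subst vadd_axis) (auto simp: lattice_def)
  then show ?thesis
    using assms(4) unfolding translate_def by (metis imageI)
qed

lemma translate_axisE:
  assumes "v \<in> translate (axis d i a) U" "U \<subseteq> lattice d" "i < d"
  obtains w where "w \<in> U" "v = w[i := w ! i + a]"
  using assms vadd_axis[of _ d i a] unfolding translate_def by blast

lemma vadd_lattice: "u \<in> lattice d \<Longrightarrow> v \<in> lattice d \<Longrightarrow> vadd u v \<in> lattice d"
  by (simp add: vadd_def lattice_def)

lemma vadd_commute: "vadd u v = vadd v u"
  by (rule nth_equalityI) (simp_all add: vadd_def add.commute)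

lemma translate_uminus:
  assumes "v \<in> lattice d" "U \<subseteq> lattice d"
  shows "translate (map uminus v) (translate v U) = U"
proof -
  have "vadd (map uminus v) (vadd v u) = u" if "u \<in> U" for u
    using that assms by (intro nth_equalityI) (auto simp: vadd_def lattice_def subset_iff)
  then show ?thesis
    by (simp add: translate_def image_image)
qed

section \<open>Pattern counts of a subshift\<close>

locale subshift_over =
  fixes d :: nat and A :: "nat set" and \<Sigma> :: "(int list \<Rightarrow> nat) set"
  assumes subshift: "subshift d A \<Sigma>"
begin

lemma finite_alphabet: "finite A"
  using subshift by (simp add: subshift_def)

lemma configurations: "\<Sigma> \<subseteq> lattice d \<rightarrow>\<^sub>E A"
  using subshift closedin_subset unfolding subshift_def by fastforce

lemma nonempty: "\<Sigma> \<noteq> {}"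
  using subshift by (simp add: subshift_def)

lemma shift_image: "v \<in> lattice d \<Longrightarrow> shift d v ` \<Sigma> = \<Sigma>"
  using subshift by (simp add: subshift_def)

definition complexity :: "int list set \<Rightarrow> nat" where
  "complexity U = card (language_on \<Sigma> U)"

lemma finite_language_on:
  assumes "finite U" "U \<subseteq> lattice d"
  shows "finite (language_on \<Sigma> U)"
proof -
  have "x v \<in> A" if "x \<in> \<Sigma>" "v \<in> U" for x v
    using configurations that assms(2) by blast
  then have "language_on \<Sigma> U \<subseteq> {p. dom p = U \<and> ran p \<subseteq> A}"
    by (auto simp: language_on_def pattern_at_def ran_def restrict_map_def split: if_splits)
  then show ?thesis
    using finite_set_of_finite_maps[OF assms(1) finite_alphabet] finite_subset by blast
qed

lemma complexity_pos: "finite U \<Longrightarrow> U \<subseteq> lattice d \<Longrightarrow> 1 \<le> complexity U"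
  unfolding complexity_def Suc_le_eq One_nat_def card_gt_0_iff
  using finite_language_on nonempty by (auto simp: language_on_def)

lemma dom_pattern_at: "dom (pattern_at x U) = U"
  by (auto simp: pattern_at_def)

lemma pattern_at_restrict: "U \<subseteq> V \<Longrightarrow> pattern_at x V |` U = pattern_at x U"
  by (simp add: pattern_at_def Int_absorb1)

lemma complexity_mono:
  assumes "U \<subseteq> V" "finite V" "V \<subseteq> lattice d"
  shows "complexity U \<le> complexity V"
proof -
  have "language_on \<Sigma> U = (\<lambda>p. p |` U) ` language_on \<Sigma> V"
    by (simp add: language_on_def image_image pattern_at_restrict[OF assms(1)])
  then show ?thesis
    unfolding complexity_def
    by (simp only:) (intro card_image_le finite_language_on assms)
qed

lemma complexity_Un_le:
  assumes "finite U" "U \<subseteq> lattice d" "finite V" "V \<subseteq> lattice d"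
  shows "complexity (U \<union> V) \<le> complexity U * complexity V"
proof -
  let ?g = "\<lambda>p. (p |` U, p |` V)"
  have "inj_on ?g (language_on \<Sigma> (U \<union> V))"
  proof
    have dom: "dom r = U \<union> V" if "r \<in> language_on \<Sigma> (U \<union> V)" for r
      using that unfolding language_on_def by (elim imageE) (simp only: dom_pattern_at)
    fix p q assume pq: "p \<in> language_on \<Sigma> (U \<union> V)" "q \<in> language_on \<Sigma> (U \<union> V)" "?g p = ?g q"
    then have "p |` U = q |` U" "p |` V = q |` V"
      by auto
    with dom[OF pq(1)] dom[OF pq(2)] show "p = q"
      by (metis Un_iff domIff ext restrict_in)
  qed
  moreover have "?g ` language_on \<Sigma> (U \<union> V) \<subseteq> language_on \<Sigma> U \<times> language_on \<Sigma> V"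
    by (auto simp: language_on_def pattern_at_restrict)
  ultimately have "card (language_on \<Sigma> (U \<union> V)) \<le> card (language_on \<Sigma> U \<times> language_on \<Sigma> V)"
    using finite_language_on assms by (intro card_inj_on_le[of ?g]) auto
  then show ?thesis
    by (simp add: complexity_def card_cartesian_product)
qed

text \<open>Restriction to the two parts is always injective on patterns over the union; gluing
  makes it onto the product as well.\<close>

lemma complexity_Un_ge:
  assumes "finite U" "U \<subseteq> lattice d" "finite V" "V \<subseteq> lattice d"
    and glue: "\<And>x y. x \<in> \<Sigma> \<Longrightarrow> y \<in> \<Sigma> \<Longrightarrow>
      \<exists>z\<in>\<Sigma>. pattern_at z U = pattern_at x U \<and> pattern_at z V = pattern_at y V"
  shows "complexity U * complexity V \<le> complexity (U \<union> V)"
proof -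
  let ?g = "\<lambda>p. (p |` U, p |` V)"
  have "language_on \<Sigma> U \<times> language_on \<Sigma> V \<subseteq> ?g ` language_on \<Sigma> (U \<union> V)"
  proof
    fix r assume "r \<in> language_on \<Sigma> U \<times> language_on \<Sigma> V"
    then obtain x y where xy: "x \<in> \<Sigma>" "y \<in> \<Sigma>" "r = (pattern_at x U, pattern_at y V)"
      by (auto simp: language_on_def)
    then obtain z where "z \<in> \<Sigma>" "pattern_at z U = pattern_at x U" "pattern_at z V = pattern_at y V"
      using glue by blast
    then show "r \<in> ?g ` language_on \<Sigma> (U \<union> V)"
      using xy by (auto simp: language_on_def image_image pattern_at_restrict intro!: rev_image_eqI[of z])
  qed
  then have "card (language_on \<Sigma> U \<times> language_on \<Sigma> V) \<le> card (language_on \<Sigma> (U \<union> V))"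
    using finite_language_on[of "U \<union> V"] assms by (intro surj_card_le) auto
  then show ?thesis
    by (simp add: complexity_def card_cartesian_product)
qed

lemma finite_translate: "finite U \<Longrightarrow> finite (translate v U)"
  by (simp add: translate_def)

lemma translate_lattice: "v \<in> lattice d \<Longrightarrow> U \<subseteq> lattice d \<Longrightarrow> translate v U \<subseteq> lattice d"
  by (auto simp: translate_def intro: vadd_lattice)

text \<open>By shift invariance, reading a pattern at the displaced positions maps the language over
  the translate onto the language over \<open>U\<close>. The other inequality is the same one for
  the opposite vector.\<close>

lemma complexity_translate:
  assumes "v \<in> lattice d" "finite U" "U \<subseteq> lattice d"
  shows "complexity (translate v U) = complexity U"
proof (rule antisym)
  have le: "complexity U \<le> complexity (translate v U)"
    if "v \<in> lattice d" "finite U" "U \<subseteq> lattice d" for v U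
  proof -
    let ?g = "\<lambda>p i. if i \<in> U then p (vadd v i) else None"
    have "?g (pattern_at x (translate v U)) = pattern_at (shift d v x) U" for x :: "int list \<Rightarrow> nat"
      using that by (auto simp: pattern_at_def shift_def translate_def restrict_map_def vadd_commute
          fun_eq_iff subset_iff)
    then have "?g ` language_on \<Sigma> (translate v U) = (\<lambda>x. pattern_at x U) ` shift d v ` \<Sigma>"
      by (simp add: language_on_def image_image)
    then have "language_on \<Sigma> U = ?g ` language_on \<Sigma> (translate v U)"
      using shift_image[OF that(1)] by (simp add: language_on_def)
    then show ?thesis
      unfolding complexity_def
      by (simp only:) (intro card_image_le finite_language_on finite_translate translate_lattice that)
  qed
  show "complexity U \<le> complexity (translate v U)"
    by (rule le) (use assms in auto)
  have "complexity (translate v U) \<le> complexity (translate (map uminus v) (translate v U))"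
    by (rule le) (use assms finite_translate translate_lattice in \<open>auto simp: lattice_def\<close>)
  then show "complexity (translate v U) \<le> complexity U"
    using translate_uminus assms by simp
qed

section \<open>Cutting and gluing bricks along one coordinate\<close>

lemma brick_lattice: "brick d l \<subseteq> lattice d"
  by (auto simp: brick_def)

text \<open>Cut at height \<open>a\<close> in direction \<open>i\<close>: the upper part is covered
  by a translate of the brick with side \<open>b\<close>.\<close>

lemma complexity_brick_add:
  assumes "i < d"
  shows "complexity (brick d (l(i := a + b))) \<le> complexity (brick d (l(i := a))) * complexity (brick d (l(i := b)))"
proof -
  let ?V = "translate (axis d i (int a)) (brick d (l(i := b)))"
  have "brick d (l(i := a + b)) \<subseteq> brick d (l(i := a)) \<union> ?V"
  proof
    fix v assume v: "v \<in> brick d (l(i := a + b))"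
    show "v \<in> brick d (l(i := a)) \<union> ?V"
    proof (cases "v ! i < int a")
      case True
      have "v \<in> brick d (l(i := a))"
        unfolding brick_def
      proof (intro CollectI conjI allI impI)
        fix j assume "j < d"
        then show "0 \<le> v ! j" "v ! j < int ((l(i := a)) j)"
          using v True by (auto simp: brick_def split: if_splits)
      qed (use v in \<open>auto simp: brick_def\<close>)
      then show ?thesis ..
    next
      case False
      have "v[i := v ! i - int a] \<in> brick d (l(i := b))"
        using v False assms by (auto simp: brick_def lattice_def nth_list_update)
      then have "v \<in> ?V"
        using v assms brick_lattice by (intro mem_translate_axis) auto
      then show ?thesis ..
    qed
  qed
  then have "complexity (brick d (l(i := a + b))) \<le> complexity (brick d (l(i := a)) \<union> ?V)"
    by (rule complexity_mono)
      (auto intro: finite_brick finite_translate subsetD[OF brick_lattice]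
        subsetD[OF translate_lattice[OF axis_lattice brick_lattice]])
  also have "\<dots> \<le> complexity (brick d (l(i := a))) * complexity ?V"
    by (intro complexity_Un_le finite_brick finite_translate brick_lattice translate_lattice axis_lattice)
  finally show ?thesis
    using complexity_translate[OF axis_lattice finite_brick brick_lattice] by simp
qed

lemma complexity_brick_mult:
  assumes "i < d"
  shows "complexity (brick d (l(i := k * a))) \<le> complexity (brick d (l(i := a))) ^ k"
proof (induction k)
  case 0
  \<comment> \<open>The empty brick carries only the empty pattern, so the base case is a count of
    at most 1.\<close>
  have empty: "brick d (l(i := 0)) = {}"
    using assms by (auto simp: brick_def)
  have "complexity {} \<le> card {Map.empty :: int list \<rightharpoonup> nat}"
    unfolding complexity_def by (rule card_mono) (auto simp: language_on_def pattern_at_def)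
  then show ?case
    by (simp only: mult_0 empty power_0) simp
next
  case (Suc k)
  have "complexity (brick d (l(i := a + k * a))) \<le>
      complexity (brick d (l(i := a))) * complexity (brick d (l(i := k * a)))"
    by (rule complexity_brick_add[OF assms])
  also have "\<dots> \<le> complexity (brick d (l(i := a))) * complexity (brick d (l(i := a))) ^ k"
    by (rule mult_le_mono2[OF Suc])
  finally show ?case
    unfolding mult_Suc power_Suc .
qed

lemma complexity_cube_mult: "complexity (cube d (k * a)) \<le> complexity (cube d a) ^ (k ^ d)"
proof -
  \<comment> \<open>The first \<open>i\<close> sides are already enlarged, the others not; each
    further side contributes a factor \<open>k\<close> to the exponent.\<close>
  let ?l = "\<lambda>i j. if j < i then k * a else a"
  have "complexity (brick d (?l i)) \<le> complexity (cube d a) ^ (k ^ i)" if "i \<le> d" for i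
    using that
  proof (induction i)
    case 0
    show ?case by (simp add: cube_eq_brick)
  next
    case (Suc i)
    have "?l (Suc i) = (?l i)(i := k * a)" and l: "(?l i)(i := a) = ?l i"
      by (auto simp: less_Suc_eq)
    then have "complexity (brick d (?l (Suc i))) \<le> complexity (brick d (?l i)) ^ k"
      using complexity_brick_mult[of i "?l i" k a] Suc.prems unfolding l by simp
    also have "\<dots> \<le> (complexity (cube d a) ^ (k ^ i)) ^ k"
      using Suc by (intro power_mono) auto
    finally show ?case
      by (simp add: power_mult[symmetric] mult.commute)
  qed
  from this[of d] show ?thesis
    by (simp add: cube_eq_brick brick_cong[of d "?l d" "\<lambda>_. k * a"])
qed

text \<open>A gluing of the enclosing cubes restricts to a gluing of the bricks. In direction
  \<open>i\<close> the two bricks and the gap together have length \<open>n + f (4 * n) + n\<close>,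
  so independent pairs of patterns extend to the longer brick.\<close>

lemma complexity_brick_double:
  assumes "block_gluing d f \<Sigma>" "mono f" "i < d" "n \<ge> 1" "\<And>j. j < d \<Longrightarrow> l j \<le> 4 * n"
  shows "(complexity (brick d (l(i := n))))\<^sup>2 \<le> complexity (brick d (l(i := 2 * n + f (4 * n))))"
proof -
  let ?s = "f (4 * n)"
  let ?U = "brick d (l(i := n))"
  \<comment> \<open>The offset \<open>- 3 * int n\<close> lets the first cube end where the first
    brick ends in direction \<open>i\<close>, after \<open>n\<close> cells; the offset
    \<open>n + f (4 * n)\<close> lets the second cube begin behind the gap, together with the second
    brick.\<close>
  let ?a = "- 3 * int n" and ?b = "int n + int ?s"
  let ?V = "translate (axis d i ?b) ?U"
  \<comment> \<open>The two bricks are enclosed in cubes that extend away from each other.\<close>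
  let ?C = "translate (axis d i ?a) (cube d (4 * n))"
  let ?D = "translate (axis d i ?b) (cube d (4 * n))"
  have U4: "?U \<subseteq> cube d (4 * n)"
  proof
    fix v assume v: "v \<in> ?U"
    have "v ! j < int (4 * n)" if "j < d" for j
    proof -
      have "v ! j < int ((l(i := n)) j)"
        using v that by (auto simp: brick_def)
      also have "\<dots> \<le> int (4 * n)"
        using assms(5)[OF that] by simp
      finally show ?thesis .
    qed
    then show "v \<in> cube d (4 * n)"
      using v by (auto simp: cube_eq_brick brick_def)
  qed
  have "?U \<subseteq> ?C"
  proof
    fix v assume v: "v \<in> ?U"
    then have v4: "v \<in> cube d (4 * n)" "0 \<le> v ! i" "v ! i < int n"
      using U4 assms(3) by (auto simp: brick_def)
    then have "v[i := v ! i - ?a] \<in> cube d (4 * n)"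
      using assms(3) by (auto simp: cube_eq_brick brick_def lattice_def nth_list_update)
    then show "v \<in> ?C"
      using assms(3) v brick_lattice by (intro mem_translate_axis) (auto simp: cube_eq_brick)
  qed
  have "?V \<subseteq> ?D"
    using U4 by (auto simp: translate_def)
  have coord: "\<exists>u\<in>cube d (4 * n). w = u[i := u ! i + c]"
    if "w \<in> translate (axis d i c) (cube d (4 * n))" for w c
    using that assms(3) brick_lattice by (elim translate_axisE) (auto simp: cube_eq_brick)
  have C_less: "w ! i < int n" if w: "w \<in> ?C" for w
  proof -
    obtain u where "u \<in> cube d (4 * n)" "w = u[i := u ! i + ?a]"
      using coord[OF w] by blast
    then show ?thesis
      using assms(3) by (auto simp: cube_eq_brick brick_def lattice_def)
  qed
  have D_ge: "?b \<le> w ! i" if w: "w \<in> ?D" for w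
  proof -
    obtain u where "u \<in> cube d (4 * n)" "w = u[i := u ! i + ?b]"
      using coord[OF w] by blast
    then show ?thesis
      using assms(3) by (auto simp: cube_eq_brick brick_def lattice_def)
  qed
  have disjoint: "?C \<inter> ?D = {}"
    using C_less D_ge by force
  have "replicate d 0 \<in> cube d (4 * n)"
    using assms(4) by (simp add: cube_eq_brick brick_def lattice_def)
  then have cube: "finite (cube d (4 * n))" "cube d (4 * n) \<noteq> {}"
    by (auto simp: cube_eq_brick finite_brick)
  have diam: "zdiam d (translate (axis d i c) (cube d (4 * n))) \<le> 4 * n" for c
  proof -
    let ?E = "translate (axis d i c) (cube d (4 * n))"
    have "zdist d p q \<le> 4 * n" if pq: "p \<in> ?E" "q \<in> ?E" for p q
    proof -
      obtain u v where uv: "u \<in> cube d (4 * n)" "p = u[i := u ! i + c]"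
          "v \<in> cube d (4 * n)" "q = v[i := v ! i + c]"
        using coord[OF pq(1)] coord[OF pq(2)] by blast
      have "\<bar>p ! k - q ! k\<bar> \<le> int (4 * n)" if "k < d" for k
      proof -
        have "p ! k - q ! k = u ! k - v ! k"
          using uv that by (cases "k = i") (auto simp: cube_eq_brick brick_def lattice_def)
        moreover have "0 \<le> u ! k" "u ! k < int (4 * n)" "0 \<le> v ! k" "v ! k < int (4 * n)"
          using uv that by (auto simp: cube_eq_brick brick_def)
        ultimately show ?thesis
          by linarith
      qed
      then show ?thesis
        using assms(3) unfolding zdist_def by (subst Max_le_iff) (auto simp: nat_le_iff)
    qed
    moreover have "{zdist d p q |p q. p \<in> ?E \<and> q \<in> ?E} = (\<lambda>(p, q). zdist d p q) ` (?E \<times> ?E)"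
      by auto
    moreover have "finite ?E" "?E \<noteq> {}"
      using cube by (auto simp: translate_def)
    ultimately show ?thesis
      unfolding zdiam_def by (subst Max_le_iff) auto
  qed
  have dist: "?s \<le> zsetdist d ?C ?D"
  proof -
    have "?s \<le> zdist d p q" if "p \<in> ?C" "q \<in> ?D" for p q
    proof -
      have "int ?s \<le> \<bar>p ! i - q ! i\<bar>"
        using C_less[OF that(1)] D_ge[OF that(2)] by linarith
      then have "?s \<le> nat \<bar>p ! i - q ! i\<bar>"
        by simp
      also have "\<dots> \<le> zdist d p q"
        unfolding zdist_def using assms(3) by (intro Max_ge) auto
      finally show ?thesis .
    qed
    moreover have "{zdist d p q |p q. p \<in> ?C \<and> q \<in> ?D} = (\<lambda>(p, q). zdist d p q) ` (?C \<times> ?D)"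
      by auto
    moreover have "finite ?C" "?C \<noteq> {}" "finite ?D" "?D \<noteq> {}"
      using cube by (auto simp: translate_def)
    ultimately show ?thesis
      unfolding zsetdist_def by (subst Min_ge_iff) auto
  qed
  \<comment> \<open>As \<open>f\<close> is monotone, the crude bound \<open>4 * n\<close> on both
    diameters is enough.\<close>
  have "f (max (zdiam d ?C) (zdiam d ?D)) \<le> zsetdist d ?C ?D"
    using order.trans[OF monoD[OF assms(2)] dist] diam by simp
  moreover have "\<exists>z\<in>\<Sigma>. pattern_at z ?C = u \<and> pattern_at z ?D = v"
    if "?C \<inter> ?D = {}" "f (max (zdiam d ?C) (zdiam d ?D)) \<le> zsetdist d ?C ?D"
      "u \<in> language_on \<Sigma> ?C" "v \<in> language_on \<Sigma> ?D" for u v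
    using assms(1)[unfolded block_gluing_def Let_def, rule_format, of "4 * n" "axis d i ?a" "axis d i ?b" u v]
      that assms(4) axis_lattice by simp
  ultimately have glue: "\<exists>z\<in>\<Sigma>. pattern_at z ?C = pattern_at x ?C \<and> pattern_at z ?D = pattern_at y ?D"
    if "x \<in> \<Sigma>" "y \<in> \<Sigma>" for x y
    using disjoint that by (simp add: language_on_def)
  have V: "finite ?V" "?V \<subseteq> lattice d"
    by (intro finite_brick finite_translate brick_lattice translate_lattice axis_lattice)+
  have "complexity ?U * complexity ?V \<le> complexity (?U \<union> ?V)"
  proof (rule complexity_Un_ge[OF finite_brick brick_lattice V])
    fix x y assume "x \<in> \<Sigma>" "y \<in> \<Sigma>"
    then obtain z where "z \<in> \<Sigma>" "pattern_at z ?C = pattern_at x ?C" "pattern_at z ?D = pattern_at y ?D"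
      using glue by blast
    then show "\<exists>z\<in>\<Sigma>. pattern_at z ?U = pattern_at x ?U \<and> pattern_at z ?V = pattern_at y ?V"
      using pattern_at_restrict[OF \<open>?U \<subseteq> ?C\<close>] pattern_at_restrict[OF \<open>?V \<subseteq> ?D\<close>] by metis
  qed
  also have "complexity (?U \<union> ?V) \<le> complexity (brick d (l(i := 2 * n + ?s)))"
  proof (rule complexity_mono[OF _ finite_brick brick_lattice])
    have "v \<in> brick d (l(i := 2 * n + ?s))" if "v \<in> ?U" for v
      using that assms(3) by (fastforce simp: brick_def split: if_splits)
    moreover have "v \<in> brick d (l(i := 2 * n + ?s))" if v: "v \<in> ?V" for v
    proof -
      obtain u where "u \<in> ?U" "v = u[i := u ! i + ?b]"
        using v assms(3) brick_lattice by (elim translate_axisE) auto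
      then show ?thesis
        using assms(3) by (auto simp: brick_def lattice_def nth_list_update)
    qed
    ultimately show "?U \<union> ?V \<subseteq> brick d (l(i := 2 * n + ?s))"
      by blast
  qed
  finally show ?thesis
    by (simp add: complexity_translate[OF axis_lattice finite_brick brick_lattice] power2_eq_square)
qed

text \<open>Treating the directions one after another squares the count \<open>d\<close> times. The
  condition \<open>f (4 * n) \<le> n\<close> keeps the sides already treated at most
  \<open>3 * n\<close>, within the cubes of side \<open>4 * n\<close> used for gluing.\<close>

lemma complexity_cube_double:
  assumes "block_gluing d f \<Sigma>" "mono f" "n \<ge> 1" "f (4 * n) \<le> n"
  shows "complexity (cube d n) ^ (2 ^ d) \<le> complexity (cube d (2 * n + f (4 * n)))"
proof -
  let ?s = "2 * n + f (4 * n)"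
  let ?l = "\<lambda>i j. if j < i then ?s else n"
  have "complexity (cube d n) ^ (2 ^ i) \<le> complexity (brick d (?l i))" if "i \<le> d" for i
    using that
  proof (induction i)
    case 0
    show ?case by (simp add: cube_eq_brick)
  next
    case (Suc i)
    have l: "?l (Suc i) = (?l i)(i := ?s)" "(?l i)(i := n) = ?l i"
      by (auto simp: less_Suc_eq)
    have "complexity (cube d n) ^ (2 ^ Suc i) = (complexity (cube d n) ^ (2 ^ i))\<^sup>2"
      by (simp add: power_mult[symmetric] mult.commute)
    also have "\<dots> \<le> (complexity (brick d (?l i)))\<^sup>2"
      using Suc by (intro power_mono) auto
    also have "\<dots> \<le> complexity (brick d (?l (Suc i)))"
      using complexity_brick_double[OF assms(1,2), of i n "?l i"] Suc.prems assms(3,4)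
      unfolding l by auto
    finally show ?case .
  qed
  from this[of d] show ?thesis
    by (simp add: cube_eq_brick brick_cong[of d "?l d" "\<lambda>_. ?s"])
qed

lemma entropy_bounds:
  assumes "block_gluing d f \<Sigma>" "mono f"
    and "summable (\<lambda>n. real (f n) / (real n)\<^sup>2)"
    and "(\<Sum>k. real (f (K + k)) / (real (K + k))\<^sup>2) \<le> \<epsilon>" "\<epsilon> \<le> 1 / 16"
    and "n \<ge> 1" "K \<le> 4 * n"
  defines "\<kappa> \<equiv> log 2 (real (card (language_on \<Sigma> (cube d n)))) / real n ^ d"
  shows "entropy d \<Sigma> \<le> \<kappa>" "\<kappa> * (1 - 8 * real d * \<epsilon>) \<le> entropy d \<Sigma>"
proof -
  let ?H = "\<lambda>n. log 2 (real (complexity (cube d n)))"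
  have cube: "finite (cube d n)" "cube d n \<subseteq> lattice d" for n
    by (simp_all add: cube_eq_brick finite_brick brick_lattice)
  have pos: "1 \<le> complexity (cube d n)" for n
    by (rule complexity_pos[OF cube])
  have nonneg: "0 \<le> ?H n" for n
    using pos[of n] by simp
  have "mono ?H"
  proof (rule monoI)
    fix m n :: nat assume "m \<le> n"
    then have "cube d m \<subseteq> cube d n"
      by (fastforce simp: cube_eq_brick brick_def)
    then have "complexity (cube d m) \<le> complexity (cube d n)"
      by (rule complexity_mono[OF _ cube])
    then show "?H m \<le> ?H n"
      using pos[of m] by simp
  qed
  have log_power: "log 2 (real (c ^ k)) = real k * log 2 (real c)" if "1 \<le> c" for c k :: nat
    using that by (simp add: log_nat_power)
  have "?H (k * a) \<le> real k ^ d * ?H a" for k a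
  proof -
    have "?H (k * a) \<le> log 2 (real (complexity (cube d a) ^ (k ^ d)))"
      using complexity_cube_mult[of k a] pos[of "k * a"] pos[of a]
      by (subst log_le_cancel_iff) auto
    then show ?thesis
      using log_power[OF pos] by simp
  qed
  from power_subadditive_limit[of ?H d, OF \<open>mono ?H\<close> nonneg this]
  obtain h where h: "(\<lambda>n. ?H n / real n ^ d) \<longlonglongrightarrow> h" "\<And>n. n \<ge> 1 \<Longrightarrow> h \<le> ?H n / real n ^ d"
    by blast
  have entropy: "entropy d \<Sigma> = h"
    using limI[OF h(1)] by (simp add: entropy_def complexity_def)
  show "entropy d \<Sigma> \<le> \<kappa>"
    using h(2)[OF assms(6)] by (simp add: entropy \<kappa>_def complexity_def)
  have "2 ^ d * ?H n \<le> ?H (2 * n + f (4 * n))" if "n \<ge> 1" "f (4 * n) \<le> n" for n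
  proof -
    have "2 ^ d * ?H n = log 2 (real (complexity (cube d n) ^ (2 ^ d)))"
      using log_power[OF pos] by simp
    also have "\<dots> \<le> ?H (2 * n + f (4 * n))"
      using complexity_cube_double[OF assms(1,2) that] pos[of n] pos[of "2 * n + f (4 * n)"]
      by (subst log_le_cancel_iff) (simp_all only: of_nat_le_iff, auto)
    finally show ?thesis .
  qed
  from doubling_lower_bound[of f ?H d h, OF assms(2) nonneg this h(1) assms(3-7)]
  show "\<kappa> * (1 - 8 * real d * \<epsilon>) \<le> entropy d \<Sigma>"
    by (simp add: entropy \<kappa>_def complexity_def)
qed

end


section \<open>The algorithm\<close>

text \<open>The integer part of the binary logarithm for positive arguments, written as a bounded
  count so that it is primitive recursive.\<close>

definition binary_log :: "nat \<Rightarrow> nat" where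
  "binary_log c = (\<Sum>k<c. of_bool (2 ^ Suc k \<le> c))"

lemma pr_binary_log [pr_intros]: "pr f \<Longrightarrow> pr (\<lambda>x. binary_log (f x))"
  unfolding binary_log_def by (rule pr_comp[where f = "\<lambda>c. \<Sum>k<c. of_bool (2 ^ Suc k \<le> c)"]) (intro pr_intros)

lemma binary_log_bounds:
  assumes "1 \<le> c"
  shows "real (binary_log c) \<le> log 2 (real c)" "log 2 (real c) \<le> real (binary_log c) + 1"
proof -
  obtain l where l: "2 ^ l \<le> c" "c < 2 ^ (l + 1)"
    using ex_power_ivl1[of 2 c] assms by auto
  have iff: "2 ^ Suc k \<le> c \<longleftrightarrow> k < l" for k
  proof
    assume "2 ^ Suc k \<le> c"
    then have "(2::nat) ^ Suc k < 2 ^ (l + 1)"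
      using l by linarith
    then show "k < l"
      by (subst (asm) power_strict_increasing_iff) auto
  next
    assume "k < l"
    then have "(2::nat) ^ Suc k \<le> 2 ^ l"
      by (intro power_increasing) auto
    then show "2 ^ Suc k \<le> c"
      using l by linarith
  qed
  have "l < c"
    using l(1) less_exp[of l] by linarith
  then have "{k \<in> {..<c}. 2 ^ Suc k \<le> c} = {..<l}"
    unfolding iff by auto
  then have [simp]: "binary_log c = l"
    unfolding binary_log_def by (simp add: sum_of_bool_eq Int_def del: power_Suc)
  have "real (2 ^ l) \<le> real c" "real c \<le> real (2 ^ (l + 1))"
    using l by (simp_all only: of_nat_le_iff)
  then have "2 powr real l \<le> real c" "real c \<le> 2 powr (real l + 1)"
    by (simp_all add: powr_realpow powr_add)
  then show "real (binary_log c) \<le> log 2 (real c)" "log 2 (real c) \<le> real (binary_log c) + 1"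
    using assms by (simp_all add: le_log_iff log_le_iff)
qed

lemma card_le_set_encode: "finite A \<Longrightarrow> card A \<le> set_encode A"
  unfolding set_encode_def card_eq_sum by (rule sum_mono) simp

text \<open>In the following, \<open>x\<close> codes the input \<open>((a, M), m)\<close>, \<open>y\<close> bounds all searches and running
  times, and \<open>R\<close> codes a machine computing the rate of convergence.\<close>

definition precision :: "nat \<Rightarrow> nat \<Rightarrow> nat" where
  "precision d x = psnd x + pfst (pfst x) + d + 4"

definition rate_run :: "nat \<Rightarrow> nat \<Rightarrow> nat \<Rightarrow> nat \<Rightarrow> nat" where
  "rate_run d R x y = run_code R (precision d x) y"

text \<open>The first summand places the cube far enough out for the tail to be small, the second
  makes the rounding of the logarithm negligible.\<close>

definition side :: "nat \<Rightarrow> nat \<Rightarrow> nat \<Rightarrow> nat \<Rightarrow> nat" where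
  "side d R x y = pfst (count_ones (rate_run d R x y) y) + 2 ^ precision d x"

definition candidate :: "nat \<Rightarrow> nat \<Rightarrow> nat \<Rightarrow> nat \<Rightarrow> nat \<Rightarrow> bool" where
  "candidate d R x y c \<longleftrightarrow> valid_code d (pfst (pfst x)) (side d R x y) c"

text \<open>The second clause says that the output of the rate machine has been read to its end. The
  equation certifies that all valid codes lie below \<open>y\<close>. Halting of the decider is
  demanded on these codes alone, since elsewhere it need not halt.\<close>

definition search_done :: "nat \<Rightarrow> nat \<Rightarrow> nat \<Rightarrow> nat \<Rightarrow> bool" where
  "search_done d R x y \<longleftrightarrow>
     halted_code R (rate_run d R x y) \<and>
     pfst (psnd (count_ones (rate_run d R x y) y)) \<noteq> 1 \<and>
     (\<Sum>c<y. of_bool (candidate d R x y c) :: nat) =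
       (\<Sum>a<pfst (pfst x). of_bool (a \<in> set_decode (pfst (pfst x)))) ^ (side d R x y ^ d) \<and>
     (\<forall>c<y. candidate d R x y c \<longrightarrow> halted_code (psnd (pfst x)) (run_code (psnd (pfst x)) c y))"

text \<open>The decider outputs 0 or 1 in unary, so the symbol under its head already tells the
  answer.\<close>

definition pattern_count :: "nat \<Rightarrow> nat \<Rightarrow> nat \<Rightarrow> nat \<Rightarrow> nat" where
  "pattern_count d R x y =
     (\<Sum>c<y. of_bool (candidate d R x y c \<and> pfst (psnd (psnd (run_code (psnd (pfst x)) c y))) = 1))"

text \<open>The doubled entries are the \<open>int_encode\<close> codes of the nonnegative integers
  \<open>p\<close> and \<open>q\<close>.\<close>

definition rational_code :: "nat \<Rightarrow> nat \<Rightarrow> nat" where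
  "rational_code p q = prod_encode (2 * p, 2 * q)"

lemma pr_rate_run [pr_intros]: "pr f \<Longrightarrow> pr g \<Longrightarrow> pr (\<lambda>x. rate_run d R (f x) (g x))"
  unfolding rate_run_def precision_def by (intro pr_intros)

lemma pr_side [pr_intros]: "pr f \<Longrightarrow> pr g \<Longrightarrow> pr (\<lambda>x. side d R (f x) (g x))"
  unfolding side_def precision_def by (intro pr_intros)

lemma prp_candidate [pr_intros]:
  "pr f \<Longrightarrow> pr g \<Longrightarrow> pr h \<Longrightarrow> prp (\<lambda>x. candidate d R (f x) (g x) (h x))"
  unfolding candidate_def by (intro pr_intros)

lemma prp_search_done: "prp (\<lambda>z. search_done d R (pfst z) (psnd z))"
  unfolding search_done_def by (intro pr_intros)

lemma pr_pattern_count: "pr (\<lambda>z. pattern_count d R (pfst z) (psnd z))"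
  unfolding pattern_count_def by (intro pr_intros)

lemma real_of_rational_code:
  "q \<noteq> 0 \<Longrightarrow> real_of_rat (nat_to_rat_surj (rational_code p q)) = real p / real q"
  by (simp add: rational_code_def nat_to_rat_surj_def int_decode_def sum_decode_def of_rat_rat)

text \<open>Every letter satisfies \<open>a < 2 ^ a \<le> set_encode A\<close>, so the bounded sum
  misses none.\<close>

lemma sum_set_decode:
  assumes "finite A"
  shows "(\<Sum>a<set_encode A. of_bool (a \<in> set_decode (set_encode A))) = card A"
proof -
  have "a < set_encode A" if "a \<in> A" for a
  proof -
    have "(2::nat) ^ a \<le> set_encode A"
      unfolding set_encode_def using that assms by (intro member_le_sum) auto
    then show ?thesis
      using less_exp[of a] by linarith
  qed
  then have "{..<set_encode A} \<inter> A = A"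
    by auto
  then show ?thesis
    using assms by (simp add: sum_of_bool_eq)
qed

section \<open>Correctness of the search on a fixed input\<close>

locale entropy_input = subshift_over d A \<Sigma>
  for d :: nat and A :: "nat set" and \<Sigma> :: "(int list \<Rightarrow> nat) set" +
  fixes M R :: tm and \<rho> :: "nat \<Rightarrow> nat" and m :: nat
  assumes decides: "decides_language M d A \<Sigma>"
    and rate: "\<And>t. tm_returns R t (\<rho> t)"
begin

definition input :: nat where
  "input = prod_encode (subshift_index A M, m)"

definition prec :: nat where
  "prec = m + set_encode A + d + 4"

definition side_length :: nat where
  "side_length = \<rho> prec + 2 ^ prec"

lemma input_simps [simp]:
  "pfst (pfst input) = set_encode A" "psnd (pfst input) = tm_code M" "psnd input = m"
  "precision d input = prec"
  by (simp_all add: input_def subshift_index_def precision_def prec_def)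

lemma rate_run_represents:
  "represents (rate_run d (tm_code R) input y) ((tm_step R ^^ y) (tm_initial prec))"
  unfolding rate_run_def using represents_run by simp

lemma side_eq:
  assumes "halted_code (tm_code R) (rate_run d (tm_code R) input y)"
    "pfst (psnd (count_ones (rate_run d (tm_code R) input y) y)) \<noteq> 1"
  shows "side d (tm_code R) input y = side_length"
proof -
  have "tm_halted R ((tm_step R ^^ y) (tm_initial prec))"
    using assms(1) halted_code_iff[OF rate_run_represents] by simp
  then have "tm_output ((tm_step R ^^ y) (tm_initial prec)) (\<rho> prec)"
    by (rule tm_returns_output[OF rate])
  moreover have "tm_output ((tm_step R ^^ y) (tm_initial prec))
      (pfst (count_ones (rate_run d (tm_code R) input y) y))"
    by (rule count_ones_output[OF rate_run_represents assms(2)])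
  ultimately show ?thesis
    unfolding side_def side_length_def using tm_output_unique by auto
qed

lemma decider_returns:
  assumes "valid_code d (set_encode A) n c"
  shows "tm_returns M c (if map_of (listing c) \<in> language d \<Sigma> then 1 else 0)"
  using decides valid_code_pattern_listings(1)[OF finite_alphabet assms]
  unfolding decides_language_def by (metis pattern_code_listing)

lemma sum_candidates:
  "(\<Sum>c<y. of_bool (valid_code d (set_encode A) n c)) = card {c. c < y \<and> valid_code d (set_encode A) n c}"
  by (simp add: sum_of_bool_eq Int_def)

text \<open>Every requirement holds from some \<open>y\<close> on, those on candidates because only
  finitely many codes are valid. Hence a common \<open>y\<close> meets them all.\<close>

lemma eventually_search_done: "\<exists>y. search_done d (tm_code R) input y"
proof -
  let ?V = "{c. valid_code d (set_encode A) side_length c}"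
  have fin: "finite ?V"
    by (rule finite_valid_code[OF finite_alphabet])
  have 1: "\<forall>\<^sub>F y in sequentially. halted_code (tm_code R) (rate_run d (tm_code R) input y)"
    unfolding halted_code_iff[OF rate_run_represents] eventually_sequentially
    by (rule tm_returns_eventually_halted[OF rate])
  have 2: "\<forall>\<^sub>F y in sequentially. \<rho> prec \<le> y"
    by (rule eventually_ge_at_top)
  have 3: "\<forall>\<^sub>F y in sequentially. \<forall>c\<in>?V. c < y"
    by (intro eventually_ball_finite fin ballI eventually_gt_at_top)
  have 4: "\<forall>\<^sub>F y in sequentially. \<forall>c\<in>?V. halted_code (tm_code M) (run_code (tm_code M) c y)"
  proof (intro eventually_ball_finite fin ballI)
    fix c assume "c \<in> ?V"
    then show "\<forall>\<^sub>F y in sequentially. halted_code (tm_code M) (run_code (tm_code M) c y)"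
      unfolding halted_code_iff[OF represents_run] eventually_sequentially
      using tm_returns_eventually_halted[OF decider_returns] by simp
  qed
  from 1 2 3 4 have "\<forall>\<^sub>F y in sequentially. search_done d (tm_code R) input y"
  proof eventually_elim
    case (elim y)
    have "tm_output ((tm_step R ^^ y) (tm_initial prec)) (\<rho> prec)"
      using elim(1) halted_code_iff[OF rate_run_represents] by (intro tm_returns_output[OF rate]) simp
    then have out: "pfst (psnd (count_ones (rate_run d (tm_code R) input y) y)) \<noteq> 1"
      by (rule count_ones_complete[OF rate_run_represents _ elim(2)])
    have side: "side d (tm_code R) input y = side_length"
      by (rule side_eq[OF elim(1) out])
    have "{c. c < y \<and> valid_code d (set_encode A) side_length c} = ?V"
      using elim(3) by auto
    then have "(\<Sum>c<y. of_bool (valid_code d (set_encode A) side_length c)) = card A ^ (side_length ^ d)"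
      unfolding sum_candidates using card_valid_code[OF finite_alphabet] by simp
    then show ?case
      unfolding search_done_def candidate_def input_simps side
      using elim(1,4) out sum_set_decode[OF finite_alphabet] by simp
  qed
  then show ?thesis
    using eventually_happens'[OF sequentially_bot] by blast
qed

lemma search_done_count:
  assumes "search_done d (tm_code R) input y"
  shows "side d (tm_code R) input y = side_length"
    and "pattern_count d (tm_code R) input y = card (language_on \<Sigma> (cube d side_length))"
proof -
  let ?V = "{c. valid_code d (set_encode A) side_length c}"
  show side: "side d (tm_code R) input y = side_length"
    using assms side_eq by (simp add: search_done_def)
  have "card {c. c < y \<and> valid_code d (set_encode A) side_length c} = card A ^ (side_length ^ d)"
    and halted: "\<And>c. c < y \<Longrightarrow> c \<in> ?V \<Longrightarrow> halted_code (tm_code M) (run_code (tm_code M) c y)"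
    using assms unfolding search_done_def candidate_def input_simps side
      sum_set_decode[OF finite_alphabet] sum_candidates by auto
  \<comment> \<open>A subset of the finite set of valid codes with its full cardinality is the whole
    set, so no valid code lies beyond \<open>y\<close>.\<close>
  then have "{c. c < y \<and> valid_code d (set_encode A) side_length c} = ?V"
    using card_valid_code[OF finite_alphabet, of d side_length] finite_valid_code[OF finite_alphabet, of d side_length]
    by (intro card_subset_eq) auto
  then have less: "c < y" if "c \<in> ?V" for c
    using that by blast
  have accept: "pfst (psnd (psnd (run_code (tm_code M) c y))) = 1 \<longleftrightarrow> map_of (listing c) \<in> language d \<Sigma>"
    if c: "c \<in> ?V" for c
  proof -
    obtain q T p where x: "(tm_step M ^^ y) (tm_initial c) = (q, T, p)"
      by (metis surj_pair)
    note rep = represents_run[of M c y, unfolded x]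
    have "tm_halted M (q, T, p)"
      using halted_code_iff[OF rep] halted[OF less[OF c] c] by blast
    then have "tm_output (q, T, p) (if map_of (listing c) \<in> language d \<Sigma> then 1 else 0)"
      using tm_returns_output[OF decider_returns] c x by (metis mem_Collect_eq)
    then show ?thesis
      unfolding represents_head[OF rep] by (auto split: if_splits)
  qed
  have "pattern_count d (tm_code R) input y =
      card {c. c < y \<and> c \<in> ?V \<and> pfst (psnd (psnd (run_code (tm_code M) c y))) = 1}"
    unfolding pattern_count_def candidate_def input_simps side by (simp add: sum_of_bool_eq Int_def)
  also have "{c. c < y \<and> c \<in> ?V \<and> pfst (psnd (psnd (run_code (tm_code M) c y))) = 1} =
      {c. valid_code d (set_encode A) side_length c \<and> map_of (listing c) \<in> language d \<Sigma>}"
    using less accept by auto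
  also have "card \<dots> = card (language_on \<Sigma> (cube d side_length))"
    by (rule card_language_on_cube[OF finite_alphabet configurations])
  finally show "pattern_count d (tm_code R) input y = card (language_on \<Sigma> (cube d side_length))" .
qed

text \<open>The error budget is split in halves: one for the distance between the entropy and the
  density on a single cube, one for rounding the logarithm to an integer.\<close>

lemma entropy_approximation:
  assumes "block_gluing d f \<Sigma>" "mono f" "d \<ge> 1"
    and "summable (\<lambda>n. real (f n) / (real n)\<^sup>2)"
    and tail: "\<And>t. (\<Sum>k. real (f (\<rho> t + k)) / (real (\<rho> t + k))\<^sup>2) \<le> 1 / 2 ^ t"
  shows "\<bar>entropy d \<Sigma> - real (binary_log (card (language_on \<Sigma> (cube d side_length)))) / real (side_length ^ d)\<bar> \<le> 1 / 2 ^ m"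
proof -
  let ?C = "card (language_on \<Sigma> (cube d side_length))"
  let ?\<kappa> = "log 2 (real ?C) / real side_length ^ d"
  let ?\<epsilon> = "1 / 2 ^ prec :: real"
  let ?a = "set_encode A"
  have cube: "finite (cube d side_length)" "cube d side_length \<subseteq> lattice d"
    by (rule finite_cube) (auto simp: cube_def)
  have C: "1 \<le> ?C"
    using complexity_pos[OF cube] by (simp add: complexity_def)
  \<comment> \<open>Each factor has its task in the bound \<open>a * 8 * d / 2 ^ prec\<close>, with
    \<open>a\<close> the alphabet code: \<open>2 ^ a\<close> absorbs \<open>a\<close>,
    \<open>2 ^ d\<close> absorbs \<open>d\<close>, \<open>2 ^ m\<close> is the demanded precision,
    and 16 leaves one half after cancelling the 8.\<close>
  have pow: "(2::real) ^ prec = 2 ^ m * 2 ^ ?a * 2 ^ d * 16"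
    by (simp add: prec_def power_add)
  have one: "(1::real) \<le> 2 ^ k" for k
    by simp
  have "(1::real) * 1 * 1 * 16 \<le> 2 ^ m * 2 ^ ?a * 2 ^ d * 16"
    by (intro mult_mono one) auto
  then have "?\<epsilon> \<le> 1 / 16"
    unfolding pow by (simp add: field_simps)
  moreover have "side_length \<ge> 1" "\<rho> prec \<le> 4 * side_length"
    by (auto simp: side_length_def Suc_le_eq)
  ultimately have bounds: "entropy d \<Sigma> \<le> ?\<kappa>" "?\<kappa> * (1 - 8 * real d * ?\<epsilon>) \<le> entropy d \<Sigma>"
    using entropy_bounds[OF assms(1,2,4) tail] by auto
  \<comment> \<open>Prepares \<open>?\<kappa> \<le> real ?a\<close>: the patterns number at most
    \<open>card A ^ (side_length ^ d)\<close>, and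
    \<open>log 2 (card A) \<le> card A \<le> set_encode A\<close>.\<close>
  have "real ?C \<le> real (card A ^ (side_length ^ d))"
  proof -
    have "?C \<le> card {c. valid_code d ?a side_length c}"
      unfolding card_language_on_cube[OF finite_alphabet configurations, symmetric]
      by (intro card_mono finite_valid_code finite_alphabet) auto
    then show ?thesis
      by (simp only: card_valid_code[OF finite_alphabet] of_nat_le_iff)
  qed
  moreover have "card A > 0"
  proof (rule ccontr)
    assume "\<not> card A > 0"
    with \<open>real ?C \<le> _\<close> C \<open>side_length \<ge> 1\<close> show False
      by (simp add: power_0_left)
  qed
  ultimately have "log 2 (real ?C) \<le> log 2 (real (card A ^ (side_length ^ d)))"
    using C by (subst log_le_cancel_iff) auto
  also have "\<dots> = real side_length ^ d * log 2 (real (card A))"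
    using \<open>card A > 0\<close> by (simp add: log_nat_power)
  finally have "?\<kappa> \<le> log 2 (real (card A))"
    using \<open>side_length \<ge> 1\<close> by (simp add: divide_le_eq mult.commute)
  also have "\<dots> \<le> real (card A)"
    using \<open>card A > 0\<close> less_exp[of "card A"]
    by (simp add: log_le_iff powr_realpow)
  also have "\<dots> \<le> real ?a"
    using card_le_set_encode[OF finite_alphabet] by simp
  finally have \<kappa>: "?\<kappa> \<le> real ?a" .
  have "?\<kappa> * (8 * real d * ?\<epsilon>) \<le> real ?a * (8 * real d * ?\<epsilon>)"
    by (intro mult_right_mono \<kappa>) auto
  also have "\<dots> = (real ?a / 2 ^ ?a) * (real d / 2 ^ d) * (1 / 2 ^ m) / 2"
    unfolding pow by simp
  also have "\<dots> \<le> 1 * 1 * (1 / 2 ^ m) / 2"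
    by (intro divide_right_mono mult_mono) (auto simp: of_nat_less_two_power less_imp_le)
  finally have gap: "?\<kappa> * (8 * real d * ?\<epsilon>) \<le> (1 / 2 ^ m) / 2"
    by simp
  \<comment> \<open>Rounding the logarithm costs at most one unit, divided by the number of cells;
    \<open>d \<ge> 1\<close> makes that number at least the side length.\<close>
  have "2 * (2::real) ^ m \<le> 2 ^ prec"
  proof -
    have "(2::real) ^ Suc m \<le> 2 ^ prec"
      by (intro power_increasing) (auto simp: prec_def)
    then show ?thesis
      by simp
  qed
  also have "(2::real) ^ prec \<le> real side_length"
    by (simp add: side_length_def)
  also have "real side_length \<le> real side_length ^ d"
    using \<open>side_length \<ge> 1\<close> assms(3) by (intro self_le_power) auto
  finally have big: "2 * (2::real) ^ m \<le> real side_length ^ d" .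
  let ?r = "real (binary_log ?C) / real (side_length ^ d)"
  have combine: "\<bar>h - r\<bar> \<le> e"
    if "r \<le> k" "k \<le> r + i" "i \<le> e / 2" "k - g \<le> h" "h \<le> k" "g \<le> e / 2" for h r k i g e :: real
    using that by linarith
  show ?thesis
  proof (rule combine[OF _ _ _ _ bounds(1) gap])
    show "?r \<le> ?\<kappa>"
      using binary_log_bounds(1)[OF C] by (simp add: divide_right_mono)
    show "?\<kappa> \<le> ?r + 1 / real side_length ^ d"
      using binary_log_bounds(2)[OF C] by (simp add: add_divide_distrib[symmetric] divide_right_mono)
    have "1 / real side_length ^ d \<le> 1 / (2 * 2 ^ m)"
      by (intro frac_le big) auto
    then show "1 / real side_length ^ d \<le> (1 / 2 ^ m) / 2"
      by simp
    show "?\<kappa> - ?\<kappa> * (8 * real d * ?\<epsilon>) \<le> entropy d \<Sigma>"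
      using bounds(2) by (simp only: right_diff_distrib mult_1_right)
  qed
qed

end

theorem theorem3p6:
  fixes d :: nat and f :: "nat \<Rightarrow> nat"
  assumes "d \<ge> 1"
    and "mono f"
    and "computable f"
    and "converges_computably (\<lambda>n. if n = 0 then 0 else real (f n) / (real n)^2)"
  shows "\<exists>E. computes_entropy E d
           {(A, \<Sigma>). decidable_subshift d A \<Sigma> \<and> block_gluing d f \<Sigma>}"
proof -
  \<comment> \<open>At \<open>n = 0\<close> the quotient is already 0, since division by zero yields
    0.\<close>
  have series: "(\<lambda>n. if n = 0 then 0 else real (f n) / (real n)^2) = (\<lambda>n. real (f n) / (real n)^2)"
    by auto
  obtain \<rho> R where summable: "summable (\<lambda>n. real (f n) / (real n)^2)"
    and R: "\<And>t. tm_returns R t (\<rho> t)"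
    and tail: "\<And>t. (\<Sum>k. real (f (\<rho> t + k)) / (real (\<rho> t + k))\<^sup>2) \<le> 1 / 2 ^ t"
    using assms(4) unfolding series converges_computably_def computable_def by blast
  let ?R = "tm_code R"
  \<comment> \<open>The search stops at a zero of its test, so the condition enters negated.\<close>
  let ?q = "\<lambda>z. of_bool (\<not> search_done d ?R (pfst z) (psnd z)) :: nat"
  let ?u = "\<lambda>z. rational_code (binary_log (pattern_count d ?R (pfst z) (psnd z)))
    (side d ?R (pfst z) (psnd z) ^ d)"
  have "pr ?q" "pr ?u"
    unfolding rational_code_def by (intro pr_intros prp_search_done pr_pattern_count)+
  \<comment> \<open>\<open>R\<close> comes from the rate of the series alone, so its code is a
    constant of the test and one \<open>E\<close> serves all subshifts and precisions.\<close>
  from tm_search[OF this] obtain E where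
    E: "\<And>x. (\<exists>y. ?q (prod_encode (x, y)) = 0) \<Longrightarrow>
      tm_returns E x (?u (prod_encode (x, LEAST y. ?q (prod_encode (x, y)) = 0)))"
    by blast
  have "\<exists>r. tm_returns E (prod_encode (subshift_index A M, m)) r \<and>
      \<bar>entropy d \<Sigma> - real_of_rat (nat_to_rat_surj r)\<bar> \<le> 1 / 2 ^ m"
    if "decidable_subshift d A \<Sigma>" "block_gluing d f \<Sigma>" "decides_language M d A \<Sigma>" for A \<Sigma> M m
  proof -
    interpret entropy_input d A \<Sigma> M R \<rho> m
      using that R by unfold_locales (auto simp: decidable_subshift_def)
    define y where "y = (LEAST y. search_done d ?R input y)"
    have y: "search_done d ?R input y"
      unfolding y_def using eventually_search_done by (rule LeastI_ex)
    define r where "r = rational_code (binary_log (pattern_count d ?R input y)) (side d ?R input y ^ d)"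
    have "tm_returns E input r"
      using E[of input] eventually_search_done by (simp add: r_def y_def)
    moreover have "side_length ^ d \<noteq> 0"
      by (simp add: side_length_def)
    then have "\<bar>entropy d \<Sigma> - real_of_rat (nat_to_rat_surj r)\<bar> \<le> 1 / 2 ^ m"
      unfolding r_def search_done_count[OF y] real_of_rational_code[OF \<open>side_length ^ d \<noteq> 0\<close>]
      by (intro entropy_approximation[OF that(2) assms(2,1) summable tail])
    ultimately show ?thesis
      unfolding input_def by blast
  qed
  then show ?thesis
    unfolding computes_entropy_def by (intro exI[of _ E]) auto
qed

end
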